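(* Let $\mathbf w=w_0w_1w_2\cdots$ be an automatic (resp. morphic) infinite word over $\{0,1,\ldots,b-1\}$ (with $b\ge2$) that has no suffix of the form $0^\omega$ and contains infinitely many maximal zero blocks. For $k\ge0$ let $(i_k,j_k)$ be the starting and ending positions of the $k$-th maximal zero block of $\mathbf w$. Then $\limsup_{k\to\infty} j_k/i_k$ is finite and rational (resp. algebraic).
   Context: Positions in infinite words are indexed from $0$. For $0\le i\le j$, $w_i\cdots w_j$ is a maximal zero block of $\mathbf w$ if $w_i=\cdots=w_j=0$, $w_{j+1}\ne0$, and either $i=0$ or $w_{i-1}\ne0$; maximal zero blocks are enumerated in increasing order of position. Morphic/automatic words: Let $\Sigma$ be a finite alphabet. A morphism $h:\Sigma^*\to\Sigma^*$ is prolongable on $a\in\Sigma$ if $h(a)=ax$ with $x\in\Sigma^+$ and $h^n(x)$ nonempty for all $n\ge0$; then $h^n(a)$ converges to the infinite word $h^\omega(a)=a\,x\,h(x)\,h^2(x)\cdots$, called a pure morphic word. A coding is a letter-to-letter morphism. An infinite word is morphic if it is the image under a coding of a pure morphic word, and automatic if it is the image under a coding of a pure morphic word $h^\omega(a)$ with $h$ uniform (all $|h(c)|$ equal). *)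

theory Defs
  imports "HOL-Analysis.Analysis" "HOL-Computational_Algebra.Polynomial" "HOL-Library.Infinite_Set"
begin

definition hom_ext :: "(nat \<Rightarrow> nat list) \<Rightarrow> nat list \<Rightarrow> nat list" where
  "hom_ext h w = concat (map h w)"

definition pure_morphic_word :: "nat set \<Rightarrow> (nat \<Rightarrow> nat list) \<Rightarrow> nat \<Rightarrow> (nat \<Rightarrow> nat) \<Rightarrow> bool" where
  "pure_morphic_word Alph h a u \<longleftrightarrow>
     finite Alph \<and> a \<in> Alph \<and> (\<forall>c\<in>Alph. set (h c) \<subseteq> Alph) \<and>
     (\<exists>x. h a = a # x \<and> x \<noteq> [] \<and> (\<forall>n. (hom_ext h ^^ n) x \<noteq> [])) \<and>
     (\<forall>n i. i < length ((hom_ext h ^^ n) [a]) \<longrightarrow> u i = (hom_ext h ^^ n) [a] ! i)"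

definition morphic_word :: "(nat \<Rightarrow> nat) \<Rightarrow> bool" where
  "morphic_word w \<longleftrightarrow> (\<exists>Alph h a u \<tau>. pure_morphic_word Alph h a u \<and> (\<forall>i. w i = \<tau> (u i)))"

definition automatic_word :: "(nat \<Rightarrow> nat) \<Rightarrow> bool" where
  "automatic_word w \<longleftrightarrow> (\<exists>Alph h a u \<tau> m. pure_morphic_word Alph h a u \<and>
      (\<forall>c\<in>Alph. length (h c) = m) \<and> (\<forall>i. w i = \<tau> (u i)))"

definition zero_block_starts :: "(nat \<Rightarrow> nat) \<Rightarrow> nat set" where
  "zero_block_starts w = {i. w i = 0 \<and> (i = 0 \<or> w (i - 1) \<noteq> 0)}"

definition zb_start :: "(nat \<Rightarrow> nat) \<Rightarrow> nat \<Rightarrow> nat" where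
  "zb_start w k = enumerate (zero_block_starts w) k"

definition zb_end :: "(nat \<Rightarrow> nat) \<Rightarrow> nat \<Rightarrow> nat" where
  "zb_end w k = (LEAST j. zb_start w k \<le> j \<and> w (Suc j) \<noteq> 0)"

end

theory Submission
  imports Defs "HOL-Computational_Algebra.Fundamental_Theorem_Algebra" "HOL-Real_Asymp.Real_Asymp"
begin

text \<open>
  Let the word be \<^term>\<open>\<tau>\<close> applied to the fixed point \<^term>\<open>u\<close> of \<^term>\<open>h\<close>. A zero block is located by the
  highest level \<^term>\<open>n\<close> at which it still contains an endpoint of some image of a letter under the \<^term>\<open>n\<close>-th
  iterate of \<^term>\<open>h\<close>: it then starts in the image of a letter at position \<^term>\<open>Pc\<close> and ends in the image of
  a letter at position \<^term>\<open>Pd\<close>, and both letters descend from one letter at position \<^term>\<open>R\<close>. If this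
  letter has occurred often before, the image is short compared with its starting position, so ratios
  bounded away from 1 come from finitely many pairs \<^term>\<open>(Pc, Pd)\<close>.

  For a fixed pair, start and end of the block are functions of \<^term>\<open>n\<close>. The set of letters whose
  \<^term>\<open>n\<close>-th image codes to zeros only is eventually periodic in \<^term>\<open>n\<close>, so along a residue class these functions
  are coordinates of a linear system with a nonnegative integer matrix. Passing to a power of the
  matrix whose support is transitive, every coordinate that is not eventually zero is asymptotic to
  \<^term>\<open>C * real (k choose D) * r ^ k\<close> with positive \<^term>\<open>C\<close> and \<^term>\<open>r\<close>: Cesaro means show that \<^term>\<open>r\<close> is among the dominant
  eigenvalues, and a maximum principle on the loops of the matrix excludes all others. Here \<^term>\<open>r\<close> is
  a root of a rational polynomial and \<^term>\<open>C\<close> lies in every subfield containing \<^term>\<open>r\<close>, hence so does the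
  limit of the ratio. For uniform morphisms \<^term>\<open>r\<close> is an integer.
\<close>

section \<open>Linear recurrences and exponential polynomials\<close>

text \<open>Gaussian elimination by induction on the columns: a row with a nonzero entry in the new
  column \<open>t\<close> serves as pivot \<open>i0\<close> and is cleared out of the other rows. It
  yields the recurrence polynomial of a linear system and, later, polynomial equations for
  quotients.\<close>

lemma linear_dependence_card:
  fixes A :: "'i \<Rightarrow> 'j \<Rightarrow> 'a::field"
  assumes "finite T" "finite S" "card S > card T"
  shows "\<exists>c. (\<exists>i\<in>S. c i \<noteq> 0) \<and> (\<forall>j\<in>T. (\<Sum>i\<in>S. c i * A i j) = 0)"
  using assms
proof (induction T arbitrary: S A rule: finite_induct)
  case empty
  then have "S \<noteq> {}" by auto
  then show ?case by (intro exI[of _ "\<lambda>_. 1"]) auto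
next
  case (insert t T)
  show ?case
  proof (cases "\<forall>i\<in>S. A i t = 0")
    case True
    have "card S > card T" using insert by simp
    from insert.IH[OF insert.prems(1) this, of A] True show ?thesis by auto
  next
    case False
    then obtain i0 where i0: "i0 \<in> S" "A i0 t \<noteq> 0" by auto
    define S' where "S' = S - {i0}"
    have S': "finite S'" "card S' > card T" "S = insert i0 S'" "i0 \<notin> S'"
      using insert.prems insert.hyps i0 by (auto simp: S'_def)
    define B where "B i j = A i j - A i t / A i0 t * A i0 j" for i j
    obtain c where c: "\<exists>i\<in>S'. c i \<noteq> 0" "\<forall>j\<in>T. (\<Sum>i\<in>S'. c i * B i j) = 0"
      using insert.IH[OF S'(1,2), of B] by blast
    \<comment> \<open>The coefficient of the pivot row is chosen so that column \<open>t\<close>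
      cancels.\<close>
    define c' where "c' = c(i0 := - (\<Sum>i\<in>S'. c i * A i t) / A i0 t)"
    have eq: "(\<Sum>i\<in>S. c' i * A i j)
        = - (\<Sum>i\<in>S'. c i * A i t) / A i0 t * A i0 j + (\<Sum>i\<in>S'. c i * A i j)" for j
    proof -
      have "(\<Sum>i\<in>S'. c' i * A i j) = (\<Sum>i\<in>S'. c i * A i j)"
        using S' by (intro sum.cong) (auto simp: c'_def)
      then show ?thesis using S' by (simp add: c'_def)
    qed
    have "(\<Sum>i\<in>S. c' i * A i j) = 0" if "j \<in> T" for j
    proof -
      have "0 = (\<Sum>i\<in>S'. c i * B i j)" using c that by auto
      also have "\<dots> = (\<Sum>i\<in>S'. c i * A i j) - (\<Sum>i\<in>S'. c i * A i t) / A i0 t * A i0 j"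
        by (simp add: B_def algebra_simps sum_subtractf sum_distrib_left sum_distrib_right sum_divide_distrib)
      finally show ?thesis unfolding eq by simp
    qed
    moreover have "(\<Sum>i\<in>S. c' i * A i t) = 0" unfolding eq using i0 by simp
    moreover have "\<exists>i\<in>S. c' i \<noteq> 0" using c S' by (auto simp: c'_def)
    ultimately show ?thesis by blast
  qed
qed

section \<open>Polynomials in the shift operator\<close>

definition shift_act :: "'a::comm_ring_1 poly \<Rightarrow> (nat \<Rightarrow> 'a) \<Rightarrow> nat \<Rightarrow> 'a" where
  "shift_act p x k = (\<Sum>i\<le>degree p. coeff p i * x (k + i))"

lemma shift_act_bound:
  assumes "degree p \<le> n"
  shows "shift_act p x k = (\<Sum>i\<le>n. coeff p i * x (k + i))"
  unfolding shift_act_def using assms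
  by (intro sum.mono_neutral_left) (auto simp: coeff_eq_0)

lemma shift_act_0 [simp]: "shift_act 0 x k = 0"
  by (simp add: shift_act_def)

lemma shift_act_1 [simp]: "shift_act 1 x k = x k"
  by (simp add: shift_act_def)

lemma shift_act_pCons [simp]: "shift_act (pCons a p) x k = a * x k + shift_act p x (Suc k)"
proof -
  have "shift_act (pCons a p) x k = (\<Sum>i\<le>Suc (degree p). coeff (pCons a p) i * x (k + i))"
    by (rule shift_act_bound) (rule degree_pCons_le)
  also have "\<dots> = a * x k + shift_act p x (Suc k)"
    by (subst sum.atMost_Suc_shift) (simp add: shift_act_def)
  finally show ?thesis .
qed

lemma shift_act_add: "shift_act (p + q) x k = shift_act p x k + shift_act q x k"
proof -
  define n where "n = max (degree p) (degree q)"
  have "degree (p + q) \<le> n" "degree p \<le> n" "degree q \<le> n"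
    by (auto simp: n_def degree_add_le)
  then show ?thesis
    by (simp add: shift_act_bound[where n = n] algebra_simps sum.distrib)
qed

lemma shift_act_smult: "shift_act (smult a p) x k = a * shift_act p x k"
  by (subst shift_act_bound[of _ "degree p"])
     (simp_all add: degree_smult_le shift_act_def sum_distrib_left mult.assoc)

text \<open>Multiplication of polynomials becomes composition of operators, so a recurrence can be
  solved one linear factor at a time.\<close>

lemma shift_act_mult: "shift_act (p * q) x k = shift_act p (shift_act q x) k"
  by (induction p arbitrary: k) (simp_all add: shift_act_add shift_act_smult)

text \<open>A pair \<open>f\<close> consists of a base and a degree. Binomials replace powers of
  \<open>k\<close> because Pascal's rule gives their differences directly. Equality is demanded only
  eventually, so that a root 0 of the recurrence does no harm.\<close>

definition exp_poly :: "(nat \<Rightarrow> complex) \<Rightarrow> bool" where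
  "exp_poly x \<longleftrightarrow> (\<exists>F c. finite F \<and> (\<forall>f\<in>F. fst f \<noteq> 0) \<and>
     (\<forall>\<^sub>F k in sequentially. x k = (\<Sum>f\<in>F. c f * of_nat (k choose snd f) * fst f ^ k)))"

lemma exp_poly_cong:
  assumes "\<forall>\<^sub>F k in sequentially. x k = y k" "exp_poly y"
  shows "exp_poly x"
proof -
  obtain F c where F: "finite F" "\<forall>f\<in>F. fst f \<noteq> 0"
     "\<forall>\<^sub>F k in sequentially. y k = (\<Sum>f\<in>F. c f * of_nat (k choose snd f) * fst f ^ k)"
    using assms(2) by (auto simp: exp_poly_def)
  have "\<forall>\<^sub>F k in sequentially. x k = (\<Sum>f\<in>F. c f * of_nat (k choose snd f) * fst f ^ k)"
    using assms(1) F(3) by eventually_elim simp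
  then show ?thesis using F unfolding exp_poly_def by blast
qed

lemma exp_poly_0: "exp_poly (\<lambda>_. 0)"
  unfolding exp_poly_def by (rule exI[of _ "{}"]) auto

lemma exp_poly_term: "\<mu> \<noteq> 0 \<Longrightarrow> exp_poly (\<lambda>k. c * of_nat (k choose d) * \<mu> ^ k)"
  unfolding exp_poly_def by (rule exI[of _ "{(\<mu>, d)}"]) auto

lemma exp_poly_add:
  assumes "exp_poly x" "exp_poly y"
  shows "exp_poly (\<lambda>k. x k + y k)"
proof -
  obtain F c where F: "finite F" "\<forall>f\<in>F. fst f \<noteq> 0"
     "\<forall>\<^sub>F k in sequentially. x k = (\<Sum>f\<in>F. c f * of_nat (k choose snd f) * fst f ^ k)"
    using assms(1) by (auto simp: exp_poly_def)
  obtain G e where G: "finite G" "\<forall>f\<in>G. fst f \<noteq> 0"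
     "\<forall>\<^sub>F k in sequentially. y k = (\<Sum>f\<in>G. e f * of_nat (k choose snd f) * fst f ^ k)"
    using assms(2) by (auto simp: exp_poly_def)
  define C where "C f = (if f \<in> F then c f else 0) + (if f \<in> G then e f else 0)" for f
  have "\<forall>\<^sub>F k in sequentially. x k + y k = (\<Sum>f\<in>F \<union> G. C f * of_nat (k choose snd f) * fst f ^ k)"
    using F(3) G(3)
  proof eventually_elim
    case (elim k)
    have 1: "(\<Sum>f\<in>F. c f * of_nat (k choose snd f) * fst f ^ k)
      = (\<Sum>f\<in>F \<union> G. (if f \<in> F then c f else 0) * of_nat (k choose snd f) * fst f ^ k)"
      using F G by (intro sum.mono_neutral_cong_left) auto
    have 2: "(\<Sum>f\<in>G. e f * of_nat (k choose snd f) * fst f ^ k)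
      = (\<Sum>f\<in>F \<union> G. (if f \<in> G then e f else 0) * of_nat (k choose snd f) * fst f ^ k)"
      using F G by (intro sum.mono_neutral_cong_left) auto
    show ?case unfolding elim 1 2 C_def by (simp add: sum.distrib ring_distribs)
  qed
  then show ?thesis using F G unfolding exp_poly_def by (intro exI[of _ "F \<union> G"] exI[of _ C]) auto
qed

lemma exp_poly_cmult:
  assumes "exp_poly x"
  shows "exp_poly (\<lambda>k. a * x k)"
proof -
  obtain F c where F: "finite F" "\<forall>f\<in>F. fst f \<noteq> 0"
     "\<forall>\<^sub>F k in sequentially. x k = (\<Sum>f\<in>F. c f * of_nat (k choose snd f) * fst f ^ k)"
    using assms(1) by (auto simp: exp_poly_def)
  have "\<forall>\<^sub>F k in sequentially. a * x k = (\<Sum>f\<in>F. (a * c f) * of_nat (k choose snd f) * fst f ^ k)"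
    using F(3) by eventually_elim (simp add: sum_distrib_left mult.assoc)
  then show ?thesis using F unfolding exp_poly_def by (intro exI[of _ F] exI) auto
qed

lemma exp_poly_sum:
  assumes "finite F" "\<And>f. f \<in> F \<Longrightarrow> exp_poly (z f)"
  shows "exp_poly (\<lambda>k. \<Sum>f\<in>F. z f k)"
  using assms by (induction F rule: finite_induct) (auto intro: exp_poly_0 exp_poly_add)

text \<open>In the resonant case \<open>\<mu> = l\<close> the degree goes up by one. Otherwise a
  multiple of the right-hand side solves the equation up to a term of lower degree, which the
  induction on \<open>d\<close> removes.\<close>

lemma exp_poly_first_order_particular:
  assumes "\<mu> \<noteq> 0"
  shows "\<exists>z. exp_poly z \<and> (\<forall>k. z (Suc k) - l * z k = of_nat (k choose d) * \<mu> ^ k)"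
proof (cases "\<mu> = l")
  case True
  let ?z = "\<lambda>k. (1 / l) * of_nat (k choose Suc d) * l ^ k"
  have "?z (Suc k) - l * ?z k = of_nat (k choose d) * \<mu> ^ k" for k
    using True assms by (simp add: algebra_simps)
  then show ?thesis using True assms exp_poly_term[of l "1/l" "Suc d"] by (intro exI[of _ ?z]) auto
next
  case False
  show ?thesis
  proof (induction d)
    case 0
    let ?z = "\<lambda>k. (1 / (\<mu> - l)) * of_nat (k choose 0) * \<mu> ^ k"
    have "?z (Suc k) - l * ?z k = of_nat (k choose 0) * \<mu> ^ k" for k
      using False by (simp add: divide_simps) (simp add: algebra_simps)
    then show ?case using assms exp_poly_term[of \<mu> "1 / (\<mu> - l)" 0] by (intro exI[of _ ?z]) auto
  next
    case (Suc d)
    then obtain z where z: "exp_poly z" "\<And>k. z (Suc k) - l * z k = of_nat (k choose d) * \<mu> ^ k"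
      by auto
    define y where "y k = (1 / (\<mu> - l)) * of_nat (k choose Suc d) * \<mu> ^ k" for k
    \<comment> \<open>By Pascal's rule \<open>y\<close> leaves an error of degree \<open>d\<close>;
      the solution \<open>z\<close> for degree \<open>d\<close> compensates it.\<close>
    define w where "w k = y k + - \<mu> / (\<mu> - l) * z k" for k
    have y: "y (Suc k) - l * y k = of_nat (k choose Suc d) * \<mu> ^ k + \<mu> / (\<mu> - l) * (of_nat (k choose d) * \<mu> ^ k)" for k
      using False by (simp add: y_def divide_simps) (simp add: algebra_simps)
    have "w (Suc k) - l * w k = (y (Suc k) - l * y k) - \<mu> / (\<mu> - l) * (z (Suc k) - l * z k)" for k
      by (simp add: w_def algebra_simps)
    then have "w (Suc k) - l * w k = of_nat (k choose Suc d) * \<mu> ^ k" for k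
      by (simp add: y z)
    moreover have "exp_poly w" unfolding w_def y_def
      by (intro exp_poly_add exp_poly_cmult exp_poly_term z assms)
    ultimately show ?case by blast
  qed
qed

text \<open>Subtracting a particular solution, built summand by summand, leaves a sequence that is
  eventually geometric with ratio \<open>l\<close>.\<close>

lemma exp_poly_first_order:
  assumes "exp_poly g" "\<forall>\<^sub>F k in sequentially. x (Suc k) - l * x k = g k"
  shows "exp_poly x"
proof -
  obtain F c where F: "finite F" "\<forall>f\<in>F. fst f \<noteq> 0"
     "\<forall>\<^sub>F k in sequentially. g k = (\<Sum>f\<in>F. c f * of_nat (k choose snd f) * fst f ^ k)"
    using assms(1) by (auto simp: exp_poly_def)
  have "\<forall>f\<in>F. \<exists>z. exp_poly z \<and> (\<forall>k. z (Suc k) - l * z k = of_nat (k choose snd f) * fst f ^ k)"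
    using F exp_poly_first_order_particular by blast
  then obtain z where z: "\<And>f. f \<in> F \<Longrightarrow> exp_poly (z f)"
     "\<And>f k. f \<in> F \<Longrightarrow> z f (Suc k) - l * z f k = of_nat (k choose snd f) * fst f ^ k"
    by metis
  define Z where "Z k = (\<Sum>f\<in>F. c f * z f k)" for k
  have Z: "exp_poly Z" unfolding Z_def by (intro exp_poly_sum exp_poly_cmult z F)
  have ZS: "Z (Suc k) - l * Z k = (\<Sum>f\<in>F. c f * of_nat (k choose snd f) * fst f ^ k)" for k
  proof -
    have "Z (Suc k) - l * Z k = (\<Sum>f\<in>F. c f * (z f (Suc k) - l * z f k))"
      by (simp add: Z_def sum_subtractf sum_distrib_left algebra_simps)
    then show ?thesis by (simp add: z(2) mult.assoc)
  qed
  define w where "w k = x k - Z k" for k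
  have "\<forall>\<^sub>F k in sequentially. w (Suc k) = l * w k"
    using F(3) assms(2)
  proof eventually_elim
    case (elim k)
    have "x (Suc k) - l * x k = Z (Suc k) - l * Z k" using elim ZS by metis
    then show ?case by (simp add: w_def algebra_simps)
  qed
  then obtain k0 where k0: "\<And>k. k \<ge> k0 \<Longrightarrow> w (Suc k) = l * w k"
    by (auto simp: eventually_sequentially)
  have wk: "w (k0 + k) = w k0 * l ^ k" for k
    by (induction k) (simp_all add: k0)
  have "exp_poly w"
  \<comment> \<open>For ratio 0 the remainder has only finitely many nonzero values, which
    \<open>exp_poly\<close> ignores.\<close>
  proof (cases "l = 0")
    case True
    have "\<forall>\<^sub>F k in sequentially. w k = 0"
      using eventually_gt_at_top[of k0]
    proof eventually_elim
      case (elim k) then show ?case using wk[of "k - k0"] True by simp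
    qed
    then show ?thesis by (rule exp_poly_cong) (rule exp_poly_0)
  next
    case False
    have "\<forall>\<^sub>F k in sequentially. w k = (w k0 / l ^ k0) * of_nat (k choose 0) * l ^ k"
      using eventually_ge_at_top[of k0]
    proof eventually_elim
      case (elim k) then show ?case using wk[of "k - k0"] False by (simp add: power_diff)
    qed
    then show ?thesis by (rule exp_poly_cong) (rule exp_poly_term[OF False])
  qed
  from exp_poly_add[OF this Z] show ?thesis by (simp add: w_def)
qed

text \<open>Induction on the degree: over the complex numbers a root \<open>l\<close> splits off,
  the cofactor annihilates \<open>x (Suc k) - l * x k\<close>, and a first-order equation
  remains.\<close>

lemma exp_poly_of_recurrence:
  fixes p :: "complex poly"
  assumes "p \<noteq> 0" "\<forall>\<^sub>F k in sequentially. shift_act p x k = 0"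
  shows "exp_poly x"
  using assms
proof (induction "degree p" arbitrary: p x)
  case 0
  then obtain a where a: "p = [:a:]" "a \<noteq> 0" by (metis degree_eq_zeroE pCons_0_0)
  have "\<forall>\<^sub>F k in sequentially. x k = 0"
    using 0(3) by eventually_elim (use a in simp)
  then show ?case by (rule exp_poly_cong) (rule exp_poly_0)
next
  case (Suc n)
  then have "\<not> constant (poly p)" by (simp add: constant_degree)
  then obtain l where "poly p l = 0" using fundamental_theorem_of_algebra by blast
  then obtain q where q: "p = [:-l, 1:] * q" by (metis dvd_def poly_eq_0_iff_dvd)
  have q0: "q \<noteq> 0" using q Suc by auto
  have dq: "n = degree q"
  proof -
    have "degree p = degree [:-l, 1:] + degree q" unfolding q using q0 by (intro degree_mult_eq) auto
    then show ?thesis using Suc(2) by simp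
  qed
  define y where "y = shift_act [:-l, 1:] x"
  have "\<forall>\<^sub>F k in sequentially. shift_act q y k = 0"
    using Suc(4) by eventually_elim (metis q y_def shift_act_mult mult.commute)
  from Suc(1)[OF dq q0 this] have "exp_poly y" .
  moreover have "x (Suc k) - l * x k = y k" for k by (simp add: y_def flip: one_pCons)
  ultimately show ?case using exp_poly_first_order[of y x l] by simp
qed

section \<open>Binomial growth and Cesaro means\<close>

lemma power_times_geometric_tendsto_0:
  fixes t :: real
  assumes "0 \<le> t" "t < 1"
  shows "(\<lambda>k. real k ^ d * t ^ k) \<longlonglongrightarrow> 0"
proof (cases "t = 0")
  case True
  have "\<forall>\<^sub>F k in sequentially. real k ^ d * t ^ k = 0"
    using eventually_gt_at_top[of 0] by eventually_elim (simp add: True)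
  then show ?thesis by (simp add: tendsto_eventually)
next
  case False
  with assms have "0 < t" by simp
  then show ?thesis using assms(2) by real_asymp
qed

text \<open>The bounds \<open>k choose d <= k ^ d\<close> and
  \<open>(k / D) ^ D <= k choose D\<close> reduce the claim to powers of \<open>k\<close>. With
  \<open>t\<close> a quotient of moduli of bases, this orders the terms of an exponential
  polynomial: first by modulus, then by degree.\<close>

lemma binomial_geometric_ratio_tendsto_0:
  fixes t :: real
  assumes "0 \<le> t" "t < 1 \<or> (t \<le> 1 \<and> d < D)"
  shows "(\<lambda>k. real (k choose d) * t ^ k / real (k choose D)) \<longlonglongrightarrow> 0"
proof -
  have lim: "(\<lambda>k. real D ^ D * (real k ^ d * t ^ k / real k ^ D)) \<longlonglongrightarrow> 0"
  proof -
    have "(\<lambda>k. real k ^ d * t ^ k / real k ^ D) \<longlonglongrightarrow> 0"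
    proof (cases "t < 1")
      case True
      show ?thesis
      proof (rule Lim_null_comparison[OF _ power_times_geometric_tendsto_0[OF assms(1) True, of d]])
        show "\<forall>\<^sub>F k in sequentially. norm (real k ^ d * t ^ k / real k ^ D) \<le> real k ^ d * t ^ k"
          using eventually_gt_at_top[of 0]
        proof eventually_elim
          case (elim k)
          have "1 \<le> real k ^ D" using elim by (intro one_le_power) auto
          then have "real k ^ d * t ^ k / real k ^ D \<le> real k ^ d * t ^ k / 1"
            using assms(1) elim by (intro divide_left_mono) auto
          then show ?case using assms(1) elim by simp
        qed
      qed
    next
      case False
      then have t: "t = 1" "d < D" using assms by auto
      show ?thesis
      proof (rule Lim_null_comparison[OF _ lim_1_over_n])
        show "\<forall>\<^sub>F k in sequentially. norm (real k ^ d * t ^ k / real k ^ D) \<le> 1 / real k"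
          using eventually_gt_at_top[of 0]
        proof eventually_elim
          case (elim k)
          have "real k ^ Suc d \<le> real k ^ D" using elim t by (intro power_increasing) auto
          then show ?case using elim t by (simp add: divide_simps mult.commute)
        qed
      qed
    qed
    from tendsto_mult[OF tendsto_const[of "real D ^ D"] this] show ?thesis by simp
  qed
  show ?thesis
  proof (rule Lim_null_comparison[OF _ lim])
    show "\<forall>\<^sub>F k in sequentially. norm (real (k choose d) * t ^ k / real (k choose D))
        \<le> real D ^ D * (real k ^ d * t ^ k / real k ^ D)"
      using eventually_ge_at_top[of "max 1 (max d D)"]
    proof eventually_elim
      case (elim k)
      have 1: "real (k choose d) \<le> real k ^ d"
        using binomial_le_pow[of d k] elim by (simp flip: of_nat_power)
      have 2: "(real k / real D) ^ D \<le> real (k choose D)"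
        using binomial_ge_n_over_k_pow_k[of D k] elim by simp
      have pos: "(real k / real D) ^ D > 0" using elim by (cases "D = 0") auto
      have "real (k choose d) * t ^ k / real (k choose D) \<le> real k ^ d * t ^ k / (real k / real D) ^ D"
        using 1 2 pos assms(1) by (intro frac_le mult_right_mono) auto
      also have "\<dots> = real D ^ D * (real k ^ d * t ^ k / real k ^ D)"
        by (simp add: power_divide)
      finally show ?case using assms(1) by simp
    qed
  qed
qed

lemma binomial_Suc_ratio_tendsto_1: "(\<lambda>k. real (Suc k choose D) / real (k choose D)) \<longlonglongrightarrow> 1"
proof -
  have "(\<lambda>k. real (Suc k) / (real (Suc k) - real D)) \<longlonglongrightarrow> 1"
    by real_asymp
  then show ?thesis
  proof (rule Lim_transform_eventually)
    show "\<forall>\<^sub>F k in sequentially. real (Suc k) / (real (Suc k) - real D) = real (Suc k choose D) / real (k choose D)"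
      using eventually_ge_at_top[of D]
    proof eventually_elim
      case (elim k)
      have "Suc k * (k choose D) = (Suc k - D) * (Suc k choose D)"
        using binomial_absorb_comp[of "Suc k" D] by simp
      then have "real (Suc k) * real (k choose D) = (real (Suc k) - real D) * real (Suc k choose D)"
        using elim by (metis of_nat_diff of_nat_mult le_Suc_eq)
      moreover have "real (k choose D) > 0" "real (Suc k) - real D > 0" using elim by auto
      ultimately show ?case by (simp add: divide_simps mult.commute)
    qed
  qed
qed

lemma cesaro_tendsto_0:
  fixes z :: "nat \<Rightarrow> complex"
  assumes "z \<longlonglongrightarrow> 0"
  shows "(\<lambda>n. (\<Sum>k<n. z k) / of_nat n) \<longlonglongrightarrow> 0"
proof (rule LIMSEQ_I)
  fix e :: real assume e: "e > 0"
  obtain k0 where k0: "\<And>k. k \<ge> k0 \<Longrightarrow> norm (z k) < e / 2"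
    using LIMSEQ_D[OF assms, of "e/2"] e by auto
  define B where "B = (\<Sum>k<k0. norm (z k))"
  obtain n0 where n0: "real n0 > 2 * B / e" using reals_Archimedean2 by blast
  show "\<exists>no. \<forall>n\<ge>no. norm ((\<Sum>k<n. z k) / of_nat n - 0) < e"
  proof (intro exI allI impI)
    fix n assume n: "n \<ge> max (Suc k0) n0"
    have "norm (\<Sum>k<n. z k) \<le> (\<Sum>k<n. norm (z k))" by (rule norm_sum)
    also have "\<dots> = B + (\<Sum>k=k0..<n. norm (z k))"
      unfolding B_def using n by (subst sum.atLeastLessThan_concat[of 0 k0 n, unfolded atLeast0LessThan, symmetric]) auto
    also have "(\<Sum>k=k0..<n. norm (z k)) \<le> (\<Sum>k=k0..<n. e / 2)"
      by (intro sum_mono) (use k0 in \<open>auto intro: less_imp_le\<close>)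
    also have "\<dots> \<le> real n * (e / 2)" using e n by (simp add: of_nat_diff)
    also have "B < real n * (e / 2)"
    proof -
      have "2 * B / e < real n" using n0 n by simp
      then show ?thesis using e by (simp add: field_simps)
    qed
    finally have "norm (\<Sum>k<n. z k) < e * real n" by (simp add: field_simps)
    then show "norm ((\<Sum>k<n. z k) / of_nat n - 0) < e" using n
      by (simp add: norm_divide pos_divide_less_eq)
  qed
qed

text \<open>The geometric sums stay bounded by \<open>2 / norm (w - 1)\<close>, while the
  denominator grows.\<close>

lemma cesaro_unit_power:
  fixes w :: complex
  assumes "norm w = 1" "w \<noteq> 1"
  shows "(\<lambda>n. (\<Sum>k<n. w ^ k) / of_nat n) \<longlonglongrightarrow> 0"
proof -
  have "(\<lambda>n. 2 / norm (w - 1) * (1 / real n)) \<longlonglongrightarrow> 2 / norm (w - 1) * 0"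
    by (intro tendsto_intros lim_1_over_n)
  then have lim: "(\<lambda>n. 2 / norm (w - 1) * (1 / real n)) \<longlonglongrightarrow> 0" by simp
  show ?thesis
  proof (rule Lim_null_comparison[OF _ lim], intro always_eventually allI)
    fix n
    have "norm (w ^ n - 1) \<le> 2"
      using norm_triangle_ineq4[of "w ^ n" 1] assms by (simp add: norm_power)
    then have "norm (\<Sum>k<n. w ^ k) \<le> 2 / norm (w - 1)"
      using assms by (simp add: geometric_sum norm_divide divide_right_mono)
    then have "norm (\<Sum>k<n. w ^ k) / real n \<le> 2 / norm (w - 1) / real n"
      by (rule divide_right_mono) simp
    then show "norm ((\<Sum>k<n. w ^ k) / of_nat n) \<le> 2 / norm (w - 1) * (1 / real n)"
      by (simp add: norm_divide)
  qed
qed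

text \<open>Fourier inversion: multiplication by \<open>cnj v ^ k\<close> turns the frequency
  \<open>v\<close> into 1, whose mean survives, and every other frequency into one whose mean
  vanishes.\<close>

lemma cesaro_unit_power_coeff:
  fixes z :: "nat \<Rightarrow> complex"
  assumes "finite W" "\<And>w. w \<in> W \<Longrightarrow> norm w = 1" "v \<in> W"
    and "(\<lambda>k. z k - (\<Sum>w\<in>W. a w * w ^ k)) \<longlonglongrightarrow> 0"
  shows "(\<lambda>n. (\<Sum>k<n. z k * cnj v ^ k) / of_nat n) \<longlonglongrightarrow> a v"
proof -
  define y where "y k = (z k - (\<Sum>w\<in>W. a w * w ^ k)) * cnj v ^ k" for k
  have nv: "norm v = 1" using assms(2,3) by auto
  have vc: "v * cnj v = 1" using complex_norm_square[of v] nv by simp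
  have "(\<lambda>k. norm (y k)) = (\<lambda>k. norm (z k - (\<Sum>w\<in>W. a w * w ^ k)))"
    by (auto simp: y_def norm_mult norm_power nv)
  then have "y \<longlonglongrightarrow> 0" 
    using tendsto_norm_zero[OF assms(4)] by (intro tendsto_norm_zero_cancel[of y]) simp
  then have 1: "(\<lambda>n. (\<Sum>k<n. y k) / of_nat n) \<longlonglongrightarrow> 0" by (rule cesaro_tendsto_0)
  have 2: "(\<lambda>n. (\<Sum>k<n. (w * cnj v) ^ k) / of_nat n) \<longlonglongrightarrow> (if w = v then 1 else 0)" if "w \<in> W" for w
  proof (cases "w = v")
    case True
    have "(\<lambda>n. (\<Sum>k<n. (w * cnj v) ^ k) / complex_of_nat n) \<longlonglongrightarrow> 1"
    proof (rule Lim_transform_eventually[OF tendsto_const])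
      show "\<forall>\<^sub>F n in sequentially. 1 = (\<Sum>k<n. (w * cnj v) ^ k) / complex_of_nat n"
        using eventually_gt_at_top[of 0] by eventually_elim (simp add: True vc)
    qed
    then show ?thesis using True by simp
  next
    case False
    have "w * cnj v \<noteq> 1"
    proof
      assume "w * cnj v = 1"
      then have "w * (v * cnj v) = v" by (metis mult.left_commute mult.right_neutral)
      then show False using vc False by simp
    qed
    moreover have "norm (w * cnj v) = 1" using assms(2)[OF that] nv by (simp add: norm_mult)
    ultimately show ?thesis using cesaro_unit_power False by simp
  qed
  have eq: "(\<Sum>k<n. z k * cnj v ^ k) / of_nat n
     = (\<Sum>k<n. y k) / of_nat n + (\<Sum>w\<in>W. a w * ((\<Sum>k<n. (w * cnj v) ^ k) / of_nat n))" for n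
  proof -
    have "z k * cnj v ^ k = y k + (\<Sum>w\<in>W. a w * (w * cnj v) ^ k)" for k
      by (simp add: y_def algebra_simps power_mult_distrib sum_distrib_left sum_distrib_right)
    then have "(\<Sum>k<n. z k * cnj v ^ k) = (\<Sum>k<n. y k) + (\<Sum>k<n. \<Sum>w\<in>W. a w * (w * cnj v) ^ k)"
      by (simp add: sum.distrib)
    also have "(\<Sum>k<n. \<Sum>w\<in>W. a w * (w * cnj v) ^ k) = (\<Sum>w\<in>W. a w * (\<Sum>k<n. (w * cnj v) ^ k))"
      by (subst sum.swap) (simp add: sum_distrib_left)
    finally show ?thesis by (simp add: add_divide_distrib sum_divide_distrib[of _ W])
  qed
  have "(\<lambda>n. (\<Sum>k<n. z k * cnj v ^ k) / of_nat n) \<longlonglongrightarrow> 0 + (\<Sum>w\<in>W. a w * (if w = v then 1 else 0))"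
    unfolding eq by (intro tendsto_add 1 tendsto_sum tendsto_mult tendsto_const 2)
  then show ?thesis using assms(1,3) by (simp add: mult_delta_right)
qed

lemma unit_exp_sum_tendsto_0:
  fixes a :: "complex \<Rightarrow> complex"
  assumes "finite W" "\<And>w. w \<in> W \<Longrightarrow> norm w = 1" "v \<in> W"
    and "(\<lambda>k. \<Sum>w\<in>W. a w * w ^ k) \<longlonglongrightarrow> 0"
  shows "a v = 0"
proof -
  have "(\<lambda>n. (\<Sum>k<n. 0 * cnj v ^ k) / of_nat n) \<longlonglongrightarrow> a v"
    using assms tendsto_minus[OF assms(4)] by (intro cesaro_unit_power_coeff[of W]) auto
  then show ?thesis by (simp add: LIMSEQ_const_iff)
qed

text \<open>Since \<open>z\<close> is nonnegative, \<open>z k * cnj v ^ k\<close> has modulus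
  \<open>z k\<close>; the triangle inequality bounds the mean at frequency \<open>v\<close> by the
  mean at frequency 1. This is what puts the positive number \<open>r\<close> itself among the
  dominant eigenvalues.\<close>

lemma nonneg_unit_exp_sum_dominant:
  fixes z :: "nat \<Rightarrow> real"
  assumes "finite W" "\<And>w. w \<in> W \<Longrightarrow> norm w = 1" "v \<in> W" "1 \<in> W" "\<And>k. z k \<ge> 0"
    and "(\<lambda>k. complex_of_real (z k) - (\<Sum>w\<in>W. a w * w ^ k)) \<longlonglongrightarrow> 0"
  shows "norm (a v) \<le> Re (a 1)"
proof -
  have v: "(\<lambda>n. norm ((\<Sum>k<n. complex_of_real (z k) * cnj v ^ k) / of_nat n)) \<longlonglongrightarrow> norm (a v)"
    by (intro tendsto_norm cesaro_unit_power_coeff[of W]) (use assms in auto)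
  have "(\<lambda>n. (\<Sum>k<n. complex_of_real (z k) * cnj 1 ^ k) / of_nat n) \<longlonglongrightarrow> a 1"
    by (intro cesaro_unit_power_coeff[of W]) (use assms in auto)
  then have "(\<lambda>n. Re ((\<Sum>k<n. complex_of_real (z k) * cnj 1 ^ k) / of_nat n)) \<longlonglongrightarrow> Re (a 1)"
    by (rule tendsto_Re)
  then have one: "(\<lambda>n. (\<Sum>k<n. z k) / real n) \<longlonglongrightarrow> Re (a 1)"
    by (simp add: Re_divide_of_nat)
  show ?thesis
  proof (rule LIMSEQ_le[OF v one], intro exI allI impI)
    fix n
    have "norm (\<Sum>k<n. complex_of_real (z k) * cnj v ^ k) \<le> (\<Sum>k<n. norm (complex_of_real (z k) * cnj v ^ k))"
      by (rule norm_sum)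
    also have "\<dots> = (\<Sum>k<n. z k)"
      using assms by (intro sum.cong) (auto simp: norm_mult norm_power)
    finally show "norm ((\<Sum>k<n. complex_of_real (z k) * cnj v ^ k) / of_nat n) \<le> (\<Sum>k<n. z k) / real n"
      by (simp add: norm_divide divide_right_mono)
  qed
qed

section \<open>Nonnegative linear systems\<close>

text \<open>Without a loop, the finite transitive relation would be acyclic, hence would have an
  element without successor.\<close>

lemma finite_trans_total_loop:
  assumes "finite W" "W \<noteq> {}"
    and "\<And>j. j \<in> W \<Longrightarrow> \<exists>l\<in>W. P j l"
    and "\<And>i j l. i \<in> W \<Longrightarrow> j \<in> W \<Longrightarrow> l \<in> W \<Longrightarrow> P i j \<Longrightarrow> P j l \<Longrightarrow> P i l"
  shows "\<exists>l\<in>W. P l l"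
proof (rule ccontr)
  assume noloop: "\<not> (\<exists>l\<in>W. P l l)"
  define R where "R = {(j, l). j \<in> W \<and> l \<in> W \<and> P j l}"
  have "R \<subseteq> W \<times> W" by (auto simp: R_def)
  then have fin: "finite R" using assms(1) finite_subset by blast
  have "trans R" unfolding R_def trans_def using assms(4) by blast
  then have "acyclic R" using noloop by (auto simp: acyclic_def R_def)
  then have wf: "wf (R\<inverse>)" using fin finite_acyclic_wf_converse by blast
  obtain x where "x \<in> W" using assms(2) by blast
  obtain z where z: "z \<in> W" "\<And>y. (y, z) \<in> R\<inverse> \<Longrightarrow> y \<notin> W"
    by (rule wfE_min[OF wf \<open>x \<in> W\<close>]) blast
  obtain l where l: "l \<in> W" "P z l" using assms(3)[OF z(1)] by blast
  then have "(l, z) \<in> R\<inverse>" using z(1) by (simp add: R_def)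
  then show False using z(2) l(1) by blast
qed

text \<open>A maximum principle: where \<^term>\<open>norm (e j) / q j\<close> is maximal, \<^term>\<open>e / q\<close> is multiplied by
  \<^term>\<open>w\<close> along every edge, so a loop forces \<^term>\<open>w = 1\<close>.\<close>

lemma transitive_peripheral_eigenvalue:
  fixes e :: "'a \<Rightarrow> complex" and q :: "'a \<Rightarrow> real" and A :: "'a \<Rightarrow> 'a \<Rightarrow> nat"
  assumes J: "finite J"
    and trans: "\<And>i j l. i \<in> J \<Longrightarrow> j \<in> J \<Longrightarrow> l \<in> J \<Longrightarrow> A i j > 0 \<Longrightarrow> A j l > 0 \<Longrightarrow> A i l > 0"
    and r: "r > 0" and w: "norm w = 1"
    and dom: "\<And>j. j \<in> J \<Longrightarrow> norm (e j) \<le> q j"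
    and eq1: "\<And>j. j \<in> J \<Longrightarrow> r * q j = (\<Sum>l\<in>J. real (A j l) * q l)"
    and eqw: "\<And>j. j \<in> J \<Longrightarrow> of_real r * w * e j = (\<Sum>l\<in>J. of_nat (A j l) * e l)"
    and j0: "j0 \<in> J" "e j0 \<noteq> 0"
  shows "w = 1"
proof -
  have q0: "q j \<ge> 0" if "j \<in> J" for j using dom[OF that] norm_ge_zero order_trans by blast
  define P where "P = {j\<in>J. q j > 0}"
  have P: "finite P" "j0 \<in> P" using J j0 dom[OF j0(1)] zero_less_norm_iff[of "e j0"] by (auto simp: P_def simp del: zero_less_norm_iff)
  define th where "th = Max ((\<lambda>j. norm (e j) / q j) ` P)"
  have th_ge: "norm (e j) / q j \<le> th" if "j \<in> P" for j
    unfolding th_def using P that by (intro Max_ge) auto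
  have th0: "th > 0"
  proof -
    have "0 < norm (e j0) / q j0" using P j0 by (auto simp: P_def)
    then show ?thesis using th_ge[OF P(2)] by simp
  qed
  have th_bound: "norm (e l) \<le> th * q l" if "l \<in> J" for l
  proof (cases "q l > 0")
    case True
    then show ?thesis using th_ge[of l] that by (simp add: P_def pos_divide_le_eq)
  next
    case False
    then show ?thesis using dom[OF that] q0[OF that] by simp
  qed
  define W where "W = {j\<in>P. norm (e j) = th * q j}"
  have "th \<in> (\<lambda>j. norm (e j) / q j) ` P" unfolding th_def using P by (intro Max_in) auto
  then have "W \<noteq> {}" by (auto simp: W_def P_def)
  moreover have "finite W" using P(1) by (simp add: W_def)
  ultimately have W: "W \<noteq> {}" "finite W" by auto
  \<comment> \<open>At a point of \<open>W\<close> the weighted sum of the \<open>e l\<close>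
    reaches the largest modulus allowed by \<open>th * q l\<close>. Equality in the triangle
    inequality forces every successor \<open>l\<close> to have the common phase \<open>ph\<close>
    and the full modulus.\<close>
  have step: "e l = th * q l * (w * e j / (th * q j))" if j: "j \<in> W" and l: "l \<in> J" "A j l > 0" for j l
  proof -
    define ph where "ph = w * e j / (th * q j)"
    have jJ: "j \<in> J" and qj: "q j > 0" and ej: "norm (e j) = th * q j"
      using j by (auto simp: W_def P_def)
    have nph: "norm ph = 1" using qj ej w th0 by (simp add: ph_def norm_mult norm_divide)
    have ph': "w * e j = of_real (th * q j) * ph" using qj th0 by (simp add: ph_def)
    have phc: "cnj ph * ph = 1"
      using complex_norm_square[of ph] nph by (simp add: mult.commute)
    \<comment> \<open>The deficits \<open>g l\<close> are nonnegative and, by the two eigenvector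
      equations, sum to 0; so each of them vanishes.\<close>
    define g where "g l = real (A j l) * (th * q l - Re (cnj ph * e l))" for l
    have re_le: "Re (cnj ph * e m) \<le> th * q m" if "m \<in> J" for m
      using complex_Re_le_cmod[of "cnj ph * e m"] th_bound[OF that] nph by (simp add: norm_mult)
    have "(\<Sum>l\<in>J. g l) = th * (\<Sum>l\<in>J. real (A j l) * q l) - Re (cnj ph * (\<Sum>l\<in>J. of_nat (A j l) * e l))"
      by (simp add: g_def right_diff_distrib sum_subtractf sum_distrib_left Re_sum algebra_simps)
    also have "\<dots> = th * (r * q j) - Re (cnj ph * (of_real r * (w * e j)))"
      using eq1[OF jJ] eqw[OF jJ] by (simp add: mult.assoc)
    also have "cnj ph * (of_real r * (w * e j)) = of_real (r * (th * q j)) * (cnj ph * ph)"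
      unfolding ph' by (simp add: mult_ac)
    finally have "(\<Sum>l\<in>J. g l) = 0" unfolding phc by simp
    moreover have "g m \<ge> 0" if "m \<in> J" for m using re_le[OF that] by (simp add: g_def)
    ultimately have "g l = 0" using J l(1) by (simp add: sum_nonneg_eq_0_iff)
    then have re: "Re (cnj ph * e l) = th * q l" using l(2) by (simp add: g_def)
    have "norm (cnj ph * e l) \<le> Re (cnj ph * e l)"
      unfolding re using th_bound[OF l(1)] nph by (simp add: norm_mult)
    then have "Im (cnj ph * e l) = 0"
      using cmod_power2[of "cnj ph * e l"] power_mono[of "norm (cnj ph * e l)" "Re (cnj ph * e l)" 2]
        zero_le_power2[of "Im (cnj ph * e l)"] by simp
    then have "cnj ph * e l = of_real (Re (cnj ph * e l))" by (simp add: complex_eq_iff)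
    then have "cnj ph * e l = of_real (th * q l)" unfolding re .
    then have "e l = ph * of_real (th * q l)" using phc by (metis mult.assoc mult.commute mult.right_neutral)
    then show ?thesis by (simp add: ph_def mult_ac)
  qed
  have nstep: "l \<in> W" if j: "j \<in> W" and l: "l \<in> P" "A j l > 0" for j l
  proof -
    have "j \<in> P" "norm (e j) = th * q j" using j by (auto simp: W_def)
    moreover have "l \<in> J" "q l > 0" using l by (auto simp: P_def)
    ultimately have "norm (e l) = th * q l"
      using step[OF j _ l(2)] th0 w by (simp add: norm_mult norm_divide P_def)
    then show ?thesis using l by (simp add: W_def)
  qed
  \<comment> \<open>Each \<open>j\<close> in \<open>W\<close> has a successor in \<open>P\<close>
    because \<open>r * q j\<close> is positive, and \<open>W\<close> is closed under such
    successors.\<close>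
  have "\<exists>l\<in>W. A l l > 0"
  proof (rule finite_trans_total_loop[where P = "\<lambda>j l. A j l > 0", OF W(2,1)])
    fix j assume j: "j \<in> W"
    then have "j \<in> J" "q j > 0" by (auto simp: W_def P_def)
    then have "(\<Sum>l\<in>J. real (A j l) * q l) \<noteq> 0" using eq1[of j] r by (metis mult_pos_pos less_irrefl)
    then obtain l where "l \<in> J" "real (A j l) * q l \<noteq> 0" by (meson sum.not_neutral_contains_not_neutral)
    then have "l \<in> P" "A j l > 0" using q0[of l] by (auto simp: P_def)
    then show "\<exists>l\<in>W. A j l > 0" using nstep[OF j] by blast
  next
    fix i j l assume "i \<in> W" "j \<in> W" "l \<in> W" "A i j > 0" "A j l > 0"
    then show "A i l > 0" using trans[of i j l] by (simp add: W_def P_def)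
  qed
  then obtain l where l: "l \<in> W" "A l l > 0" by blast
  then have lJ: "l \<in> J" "q l > 0" "e l \<noteq> 0" using th0 by (auto simp: W_def P_def)
  have "e l = w * e l" using step[OF l(1) lJ(1) l(2)] lJ th0 by simp
  then show ?thesis using lJ by simp
qed

section \<open>Growth of the coordinates of a nonnegative linear system\<close>

definition growth :: "(nat \<Rightarrow> nat) \<Rightarrow> real \<Rightarrow> nat \<Rightarrow> real \<Rightarrow> bool" where
  "growth x r D C \<longleftrightarrow> r > 0 \<and> C > 0 \<and> (\<lambda>k. real (x k) / (real (k choose D) * r ^ k)) \<longlonglongrightarrow> C"

definition linear_system :: "'a set \<Rightarrow> ('a \<Rightarrow> 'a \<Rightarrow> nat) \<Rightarrow> (nat \<Rightarrow> 'a \<Rightarrow> nat) \<Rightarrow> bool" where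
  "linear_system I A V \<longleftrightarrow> finite I \<and> (\<forall>i\<in>I. \<forall>k. V (Suc k) i = (\<Sum>j\<in>I. A i j * V k j))"

text \<open>The \<open>card I + 1\<close> vectors \<open>V 0, ..., V n\<close> are linearly
  dependent over the rationals, and applying the matrix carries the dependence to all later times.
  One polynomial thus annihilates all coordinates at once.\<close>

lemma linear_system_annihilator:
  assumes "linear_system I A V"
  shows "\<exists>p::rat poly. p \<noteq> 0 \<and> (\<forall>i\<in>I. \<forall>k. shift_act p (\<lambda>k. of_nat (V k i)) k = 0)"
proof -
  have I: "finite I" and rec: "\<And>i k. i \<in> I \<Longrightarrow> V (Suc k) i = (\<Sum>j\<in>I. A i j * V k j)"
    using assms by (auto simp: linear_system_def)
  define n where "n = card I"
  obtain c where c: "\<exists>m\<in>{..n}. c m \<noteq> 0" "\<forall>i\<in>I. (\<Sum>m\<le>n. c m * (of_nat (V m i) :: rat)) = 0"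
    using linear_dependence_card[OF I, of "{..n}" "\<lambda>m i. of_nat (V m i)"] by (auto simp: n_def)
  define p where "p = (\<Sum>m\<le>n. monom (c m) m)"
  have cp: "coeff p m = (if m \<le> n then c m else 0)" for m
    by (auto simp: p_def coeff_sum)
  have deg: "degree p \<le> n" by (rule degree_le) (simp add: cp)
  obtain m where "m \<le> n" "c m \<noteq> 0" using c(1) by blast
  then have "coeff p m \<noteq> 0" by (simp add: cp)
  then have "p \<noteq> 0" by auto
  moreover have "\<forall>i\<in>I. shift_act p (\<lambda>k. of_nat (V k i)) k = 0" for k
  proof (induction k)
    case 0
    show ?case using c(2) by (auto simp: shift_act_bound[OF deg] cp)
  next
    case (Suc k)
    show ?case
    proof
      fix i assume i: "i \<in> I"
      have "shift_act p (\<lambda>k. of_nat (V k i)) (Suc k)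
         = (\<Sum>m\<le>n. coeff p m * (\<Sum>j\<in>I. of_nat (A i j) * of_nat (V (k + m) j)))"
        by (simp add: shift_act_bound[OF deg] rec[OF i])
      also have "\<dots> = (\<Sum>j\<in>I. of_nat (A i j) * shift_act p (\<lambda>k. of_nat (V k j)) k)"
        unfolding shift_act_bound[OF deg] sum_distrib_left
        by (subst sum.swap) (simp add: mult.left_commute)
      also have "\<dots> = 0" using Suc by simp
      finally show "shift_act p (\<lambda>k. of_nat (V k i)) (Suc k) = 0" .
    qed
  qed
  ultimately show ?thesis by blast
qed

lemma shift_act_of_rat:
  "shift_act (map_poly of_rat p) (\<lambda>k. of_nat (x k)) k
     = (of_rat (shift_act p (\<lambda>k. of_nat (x k)) k) :: 'a::field_char_0)"
  by (induction p arbitrary: k) (simp_all add: map_poly_pCons of_rat_add of_rat_mult)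

lemma map_poly_of_rat_eq_0_iff [simp]: "map_poly (of_rat :: rat \<Rightarrow> 'a::field_char_0) p = 0 \<longleftrightarrow> p = 0"
  by (simp add: poly_eq_iff coeff_map_poly)

lemma linear_system_exp_poly:
  assumes "linear_system I A V" "i \<in> I"
  shows "exp_poly (\<lambda>k. of_nat (V k i))"
proof -
  obtain p :: "rat poly" where p: "p \<noteq> 0" "\<And>k. shift_act p (\<lambda>k. of_nat (V k i)) k = 0"
    using linear_system_annihilator[OF assms(1)] assms(2) by blast
  show ?thesis
    by (rule exp_poly_of_recurrence[of "map_poly of_rat p"]) (use p in \<open>simp_all add: shift_act_of_rat\<close>)
qed

text \<open>The terms of all coordinates are collected in one index set, with coefficient 0 where a
  coordinate lacks a term.\<close>

lemma linear_system_exp_poly_uniform: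
  assumes "linear_system I A V"
  obtains F c where "finite F" "\<forall>f\<in>F. fst f \<noteq> 0"
    "\<forall>\<^sub>F k in sequentially. \<forall>j\<in>I. complex_of_nat (V k j) = (\<Sum>f\<in>F. c j f * of_nat (k choose snd f) * fst f ^ k)"
proof -
  have I: "finite I" using assms by (simp add: linear_system_def)
  have "\<forall>j\<in>I. \<exists>F c. finite F \<and> (\<forall>f\<in>F. fst f \<noteq> 0) \<and>
     (\<forall>\<^sub>F k in sequentially. complex_of_nat (V k j) = (\<Sum>f\<in>F. c f * of_nat (k choose snd f) * fst f ^ k))"
    using linear_system_exp_poly[OF assms] by (auto simp: exp_poly_def)
  then obtain G where "\<forall>j\<in>I. \<exists>c. finite (G j) \<and> (\<forall>f\<in>G j. fst f \<noteq> 0) \<and>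
     (\<forall>\<^sub>F k in sequentially. complex_of_nat (V k j) = (\<Sum>f\<in>G j. c f * of_nat (k choose snd f) * fst f ^ k))"
    unfolding bchoice_iff by blast
  then obtain c where G: "\<forall>j\<in>I. finite (G j) \<and> (\<forall>f\<in>G j. fst f \<noteq> 0) \<and>
     (\<forall>\<^sub>F k in sequentially. complex_of_nat (V k j) = (\<Sum>f\<in>G j. c j f * of_nat (k choose snd f) * fst f ^ k))"
    unfolding bchoice_iff by blast
  define F where "F = (\<Union>j\<in>I. G j)"
  have F: "finite F" using I G by (simp add: F_def)
  define C where "C j f = (if f \<in> G j then c j f else 0)" for j f
  have eq: "(\<Sum>f\<in>G j. c j f * of_nat (k choose snd f) * fst f ^ k) = (\<Sum>f\<in>F. C j f * of_nat (k choose snd f) * fst f ^ k)"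
    if "j \<in> I" for j k
    using F that by (intro sum.mono_neutral_cong_left) (auto simp: C_def F_def)
  have "\<forall>\<^sub>F k in sequentially. complex_of_nat (V k j) = (\<Sum>f\<in>F. C j f * of_nat (k choose snd f) * fst f ^ k)"
    if "j \<in> I" for j
    using G that unfolding eq[OF that, symmetric] by blast
  then have "\<forall>\<^sub>F k in sequentially. \<forall>j\<in>I. complex_of_nat (V k j) = (\<Sum>f\<in>F. C j f * of_nat (k choose snd f) * fst f ^ k)"
    using I by (intro eventually_ball_finite) blast+
  then show ?thesis by (rule that[OF F, rotated]) (use G in \<open>auto simp: F_def\<close>)
qed

text \<open>Let \<open>r\<close> and \<open>D\<close> be the largest modulus and, for it, the
  largest degree over all coordinates. After division by \<open>(k choose D) * r ^ k\<close>,
  coordinate \<open>j\<close> approaches a combination of powers \<open>w ^ k\<close> with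
  \<open>norm w = 1\<close> and coefficients \<open>e j w\<close>. For fixed \<open>w\<close> these
  form an eigenvector for \<open>r * w\<close>, dominated by the one for \<open>r\<close>; the
  maximum principle leaves only \<open>w = 1\<close>. As the root \<open>i\<close> points to every
  other coordinate, its own coefficient is positive.\<close>

lemma linear_system_rooted_growth:
  assumes sys: "linear_system J A V" and i: "i \<in> J"
    and root: "\<And>j. j \<in> J \<Longrightarrow> j = i \<or> A i j > 0"
    and trans: "\<And>i j l. i \<in> J \<Longrightarrow> j \<in> J \<Longrightarrow> l \<in> J \<Longrightarrow> A i j > 0 \<Longrightarrow> A j l > 0 \<Longrightarrow> A i l > 0"
  shows "(\<forall>\<^sub>F k in sequentially. V k i = 0) \<or> (\<exists>r D C. growth (\<lambda>k. V k i) r D C)"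
proof -
  have J: "finite J" and rec: "\<And>j k. j \<in> J \<Longrightarrow> V (Suc k) j = (\<Sum>l\<in>J. A j l * V k l)"
    using sys by (auto simp: linear_system_def)
  obtain F c where F: "finite F" "\<forall>f\<in>F. fst f \<noteq> 0"
    and rep: "\<forall>\<^sub>F k in sequentially. \<forall>j\<in>J. complex_of_nat (V k j) = (\<Sum>f\<in>F. c j f * of_nat (k choose snd f) * fst f ^ k)"
    by (rule linear_system_exp_poly_uniform[OF sys]) (rule that, assumption+)
  define N where "N = {f\<in>F. \<exists>j\<in>J. c j f \<noteq> 0}"
  show ?thesis
  proof (cases "N = {}")
    case True
    have "\<forall>\<^sub>F k in sequentially. V k i = 0"
      using rep
    proof eventually_elim
      case (elim k)
      have "complex_of_nat (V k i) = (\<Sum>f\<in>F. c i f * of_nat (k choose snd f) * fst f ^ k)"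
        using elim i by blast
      also have "\<dots> = 0" using True i by (intro sum.neutral) (auto simp: N_def)
      finally show ?case by simp
    qed
    then show ?thesis ..
  next
    case False
    have N: "finite N" "N \<subseteq> F" using F by (auto simp: N_def)
    define r where "r = Max ((\<lambda>f. norm (fst f)) ` N)"
    have r_ge: "norm (fst f) \<le> r" if "f \<in> N" for f
      unfolding r_def using N that by (intro Max_ge) auto
    have "r \<in> (\<lambda>f. norm (fst f)) ` N" unfolding r_def using N False by (intro Max_in) auto
    then obtain f1 where f1: "f1 \<in> N" "norm (fst f1) = r" by blast
    have r0: "r > 0" using f1 F N by (metis subsetD zero_less_norm_iff)
    define N' where "N' = {f\<in>N. norm (fst f) = r}"
    have N': "finite N'" "f1 \<in> N'" using N f1 by (auto simp: N'_def)
    define D where "D = Max (snd ` N')"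
    have D_ge: "snd f \<le> D" if "f \<in> N" "norm (fst f) = r" for f
      unfolding D_def using N' that by (intro Max_ge) (auto simp: N'_def)
    have "D \<in> snd ` N'" unfolding D_def using N' by (intro Max_in) auto
    then obtain f0 where f0: "f0 \<in> N" "norm (fst f0) = r" "snd f0 = D" by (auto simp: N'_def)
    define F' where "F' = {f\<in>F. norm (fst f) = r \<and> snd f = D}"
    \<comment> \<open>The frequency 1 is inserted by hand, since \<open>r\<close> is not yet known
      to be a base; \<open>e\<close> is 0 at frequencies that do not occur.\<close>
    define W where "W = insert 1 ((\<lambda>f. fst f / of_real r) ` F')"
    have W: "finite W" "1 \<in> W" "\<And>w. w \<in> W \<Longrightarrow> norm w = 1"
      using F r0 by (auto simp: W_def F'_def norm_divide)
    define e where "e j w = (if (of_real r * w, D) \<in> F then c j (of_real r * w, D) else 0)" for j w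
    define z where "z j k = real (V k j) / (real (k choose D) * r ^ k)" for j k
    define S where "S j k = (\<Sum>w\<in>W. e j w * w ^ k)" for j k
    have S_alt: "S j k = (\<Sum>f\<in>F'. c j f * (fst f / of_real r) ^ k)" for j k
    proof -
      have "S j k = (\<Sum>w\<in>{w\<in>W. (of_real r * w, D) \<in> F}. c j (of_real r * w, D) * w ^ k)"
        unfolding S_def using W(1) by (intro sum.mono_neutral_cong_right) (auto simp: e_def)
      also have "\<dots> = (\<Sum>f\<in>F'. c j f * (fst f / of_real r) ^ k)"
      proof (rule sum.reindex_bij_witness[of _ "\<lambda>f. fst f / of_real r" "\<lambda>w. (of_real r * w, D)"])
        fix f assume f: "f \<in> F'"
        then have f': "f \<in> F" "snd f = D" by (auto simp: F'_def)
        have eq: "(of_real r * (fst f / of_real r), D) = f" using f' r0 by (simp add: prod_eq_iff)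
        then show "(of_real r * (fst f / of_real r), D) = f" .
        have "fst f / of_real r \<in> W" unfolding W_def using f by blast
        then show "fst f / of_real r \<in> {w \<in> W. (of_real r * w, D) \<in> F}" using eq f'(1) by simp
      next
        fix w assume w: "w \<in> {w \<in> W. (of_real r * w, D) \<in> F}"
        then have "norm w = 1" using W(3) by blast
        then show "(of_real r * w, D) \<in> F'" using w r0 by (simp add: F'_def norm_mult)
        show "fst (of_real r * w, D) / of_real r = w" using r0 by simp
        then show "c j (of_real r * w, D) * (fst (of_real r * w, D) / of_real r) ^ k = c j (of_real r * w, D) * w ^ k"
          by simp
      qed
      finally show ?thesis .
    qed
    \<comment> \<open>Terms of \<open>F'\<close> match their summand in \<open>S\<close> exactly
      from \<open>k = D\<close> on; all others have smaller modulus or smaller degree and vanish in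
      the limit.\<close>
    have asym: "(\<lambda>k. complex_of_real (z j k) - S j k) \<longlonglongrightarrow> 0" if j: "j \<in> J" for j
    proof -
      define T where "T f k = c j f * of_nat (k choose snd f) * fst f ^ k / (of_nat (k choose D) * of_real r ^ k)" for f k
      have Tlim: "(\<lambda>k. T f k - (if f \<in> F' then c j f * (fst f / of_real r) ^ k else 0)) \<longlonglongrightarrow> 0" if f: "f \<in> F" for f
      proof (cases "f \<in> F'")
        case True
        have "\<forall>\<^sub>F k in sequentially. T f k - (if f \<in> F' then c j f * (fst f / of_real r) ^ k else 0) = 0"
          using eventually_ge_at_top[of D]
        proof eventually_elim
          case (elim k)
          then have "(k choose D) \<noteq> 0" by simp
          then show ?case using True r0 by (simp add: T_def F'_def power_divide)
        qed
        then show ?thesis by (rule tendsto_eventually)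
      next
        case False
        show ?thesis
        proof (cases "c j f = 0")
          case True
          then show ?thesis using False by (simp add: T_def)
        next
          case c0: False
          then have fN: "f \<in> N" using f j by (auto simp: N_def)
          have "norm (fst f) / r \<ge> 0" using r0 by simp
          moreover have "norm (fst f) / r < 1 \<or> (norm (fst f) / r \<le> 1 \<and> snd f < D)"
          proof (cases "norm (fst f) = r")
            case True
            then have "snd f \<noteq> D" "snd f \<le> D" using False f D_ge[OF fN] by (auto simp: F'_def)
            then show ?thesis using True r0 by simp
          next
            case less: False
            then show ?thesis using r_ge[OF fN] r0 by simp
          qed
          ultimately have "(\<lambda>k. real (k choose snd f) * (norm (fst f) / r) ^ k / real (k choose D)) \<longlonglongrightarrow> 0"
            by (rule binomial_geometric_ratio_tendsto_0)
          from tendsto_mult_right_zero[OF this, of "norm (c j f)"]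
          have "(\<lambda>k. norm (T f k)) \<longlonglongrightarrow> 0"
            using r0 by (simp add: T_def norm_mult norm_divide norm_power power_divide mult_ac)
          then show ?thesis using False by (auto intro: tendsto_norm_zero_cancel)
        qed
      qed
      have "(\<lambda>k. \<Sum>f\<in>F. T f k - (if f \<in> F' then c j f * (fst f / of_real r) ^ k else 0)) \<longlonglongrightarrow> (\<Sum>f\<in>F. 0)"
        by (intro tendsto_sum Tlim)
      then have lim: "(\<lambda>k. \<Sum>f\<in>F. T f k - (if f \<in> F' then c j f * (fst f / of_real r) ^ k else 0)) \<longlonglongrightarrow> 0"
        by simp
      have S_F: "(\<Sum>f\<in>F. if f \<in> F' then c j f * (fst f / of_real r) ^ k else 0) = S j k" for k
        unfolding S_alt using F(1) by (intro sum.mono_neutral_cong_right) (auto simp: F'_def)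
      show ?thesis
      proof (rule Lim_transform_eventually[OF lim])
        show "\<forall>\<^sub>F k in sequentially. (\<Sum>f\<in>F. T f k - (if f \<in> F' then c j f * (fst f / of_real r) ^ k else 0))
            = complex_of_real (z j k) - S j k"
          using rep
        proof eventually_elim
          case (elim k)
          then have "complex_of_nat (V k j) = (\<Sum>f\<in>F. c j f * of_nat (k choose snd f) * fst f ^ k)" using j by blast
          then have "complex_of_real (z j k) = (\<Sum>f\<in>F. T f k)"
            by (simp add: z_def T_def sum_divide_distrib)
          then show ?case by (simp add: sum_subtractf S_F)
        qed
      qed
    qed
    have dom: "norm (e j w) \<le> Re (e j 1)" if "j \<in> J" "w \<in> W" for j w
    proof (rule nonneg_unit_exp_sum_dominant[OF W(1,3) that(2) W(2)])
      show "0 \<le> z j k" for k using r0 by (simp add: z_def)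
      show "(\<lambda>k. complex_of_real (z j k) - (\<Sum>w\<in>W. e j w * w ^ k)) \<longlonglongrightarrow> 0"
        using asym[OF that(1)] by (simp add: S_def)
    qed
    \<comment> \<open>The normalised recurrence gives a combination of distinct frequencies that
      tends to 0, so its coefficients vanish one by one.\<close>
    have eig: "of_real r * w * e j w = (\<Sum>l\<in>J. of_nat (A j l) * e l w)" if j: "j \<in> J" and w: "w \<in> W" for j w
    proof -
      define b where "b k = real (Suc k choose D) / real (k choose D)" for k
      have b: "b \<longlonglongrightarrow> 1" unfolding b_def by (rule binomial_Suc_ratio_tendsto_1)
      \<comment> \<open>The factor \<open>b k\<close> accounts for normalising with
        \<open>Suc k choose D\<close> in place of \<open>k choose D\<close>; it tends to 1 and
        \<open>S\<close> is bounded.\<close>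
      have lim1: "(\<lambda>k. complex_of_real (z j (Suc k)) * of_real (b k) - S j (Suc k)) \<longlonglongrightarrow> 0"
      proof -
        have 1: "(\<lambda>k. (complex_of_real (z j (Suc k)) - S j (Suc k)) * of_real (b k)) \<longlonglongrightarrow> 0 * of_real 1"
          using LIMSEQ_Suc[OF asym[OF j]] b by (intro tendsto_intros)
        define B where "B = (\<Sum>w\<in>W. norm (e j w))"
        have SB: "norm (S j k) \<le> B" for k
        proof -
          have "norm (S j k) \<le> (\<Sum>w\<in>W. norm (e j w * w ^ k))" unfolding S_def by (rule norm_sum)
          also have "\<dots> = B" unfolding B_def using W by (intro sum.cong) (auto simp: norm_mult norm_power)
          finally show ?thesis .
        qed
        have "(\<lambda>k. B * \<bar>b k - 1\<bar>) \<longlonglongrightarrow> B * \<bar>1 - 1\<bar>" using b by (intro tendsto_intros)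
        then have B0: "(\<lambda>k. B * \<bar>b k - 1\<bar>) \<longlonglongrightarrow> 0" by simp
        have 2: "(\<lambda>k. S j (Suc k) * (of_real (b k) - 1)) \<longlonglongrightarrow> 0"
        proof (rule Lim_null_comparison[OF _ B0], intro always_eventually allI)
          fix k
          have "norm (complex_of_real (b k) - 1) = \<bar>b k - 1\<bar>"
            by (metis norm_of_real of_real_1 of_real_diff)
          then show "norm (S j (Suc k) * (of_real (b k) - 1)) \<le> B * \<bar>b k - 1\<bar>"
            using SB[of "Suc k"] by (simp add: norm_mult mult_right_mono)
        qed
        from tendsto_add[OF 1 2] show ?thesis by (simp add: algebra_simps)
      qed
      have lim2: "(\<lambda>k. \<Sum>l\<in>J. of_nat (A j l) * (complex_of_real (z l k) - S l k)) \<longlonglongrightarrow> (\<Sum>l\<in>J. of_nat (A j l) * 0)"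
        by (intro tendsto_sum tendsto_mult tendsto_const asym)
      have lim3: "(\<lambda>k. (\<Sum>l\<in>J. of_nat (A j l) * (complex_of_real (z l k) - S l k))
          - of_real r * (complex_of_real (z j (Suc k)) * of_real (b k) - S j (Suc k))) \<longlonglongrightarrow> (\<Sum>l\<in>J. of_nat (A j l) * 0) - of_real r * 0"
        by (intro tendsto_diff tendsto_mult tendsto_const lim1 lim2)
      have Seq: "of_real r * S j (Suc k) - (\<Sum>l\<in>J. of_nat (A j l) * S l k)
         = (\<Sum>w\<in>W. (of_real r * w * e j w - (\<Sum>l\<in>J. of_nat (A j l) * e l w)) * w ^ k)" for k
      proof -
        have 1: "(\<Sum>l\<in>J. of_nat (A j l) * S l k) = (\<Sum>w\<in>W. (\<Sum>l\<in>J. of_nat (A j l) * e l w) * w ^ k)"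
          unfolding S_def sum_distrib_left sum_distrib_right by (subst sum.swap) (simp add: mult.assoc)
        have 2: "of_real r * S j (Suc k) = (\<Sum>w\<in>W. (of_real r * w * e j w) * w ^ k)"
          by (simp add: S_def sum_distrib_left mult_ac)
        show ?thesis by (simp only: 1 2 left_diff_distrib sum_subtractf)
      qed
      have "(\<lambda>k. \<Sum>w\<in>W. (of_real r * w * e j w - (\<Sum>l\<in>J. of_nat (A j l) * e l w)) * w ^ k) \<longlonglongrightarrow> 0"
      proof (rule Lim_transform_eventually)
        show "(\<lambda>k. (\<Sum>l\<in>J. of_nat (A j l) * (complex_of_real (z l k) - S l k))
          - of_real r * (complex_of_real (z j (Suc k)) * of_real (b k) - S j (Suc k))) \<longlonglongrightarrow> 0"
          using lim3 by simp
        show "\<forall>\<^sub>F k in sequentially. (\<Sum>l\<in>J. of_nat (A j l) * (complex_of_real (z l k) - S l k))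
            - of_real r * (complex_of_real (z j (Suc k)) * of_real (b k) - S j (Suc k))
          = (\<Sum>w\<in>W. (of_real r * w * e j w - (\<Sum>l\<in>J. of_nat (A j l) * e l w)) * w ^ k)"
          using eventually_ge_at_top[of D]
        proof eventually_elim
          case (elim k)
          then have bpos: "real (k choose D) > 0" "real (Suc k choose D) > 0" by (auto simp del: binomial_Suc_Suc)
          have "r * (z j (Suc k) * b k) = real (V (Suc k) j) / (real (k choose D) * r ^ k)"
            using bpos r0 unfolding z_def b_def by (simp add: divide_simps)
          also have "\<dots> = (\<Sum>l\<in>J. real (A j l) * z l k)"
            by (simp add: rec[OF j] z_def sum_divide_distrib)
          finally have "complex_of_real (r * (z j (Suc k) * b k)) = of_real (\<Sum>l\<in>J. real (A j l) * z l k)" by simp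
          then show ?case unfolding Seq[symmetric]
            by (simp add: right_diff_distrib sum_subtractf)
        qed
      qed
      from unit_exp_sum_tendsto_0[OF W(1,3) w this] show ?thesis by simp
    qed
    define q where "q j = Re (e j 1)" for j
    have qeig: "r * q j = (\<Sum>l\<in>J. real (A j l) * q l)" if "j \<in> J" for j
      using arg_cong[OF eig[OF that W(2)], of Re] by (simp add: q_def Re_sum)
    have q0: "q j \<ge> 0" if "j \<in> J" for j using dom[OF that W(2)] norm_ge_zero[of "e j 1"] unfolding q_def by linarith
    obtain j0 where j0: "j0 \<in> J" "c j0 f0 \<noteq> 0" using f0 by (auto simp: N_def)
    have f0F: "f0 \<in> F'" using f0 N by (auto simp: F'_def)
    define w0 where "w0 = fst f0 / of_real r"
    have w0: "w0 \<in> W" using f0F by (auto simp: W_def w0_def)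
    have "(of_real r * w0, D) = f0" using f0 r0 by (simp add: w0_def prod_eq_iff)
    then have "e j0 w0 \<noteq> 0" using f0F j0 by (simp add: e_def F'_def)
    then have qj0: "q j0 > 0" using dom[OF j0(1) w0] unfolding q_def by (meson less_le_trans zero_less_norm_iff)
    \<comment> \<open>Some coordinate \<open>j0\<close> has a positive coefficient; the eigenvector
      equation passes positivity along the edge from \<open>i\<close> to \<open>j0\<close>.\<close>
    have qi: "q i > 0"
    proof (cases "j0 = i")
      case False
      then have Aj: "A i j0 > 0" using root[OF j0(1)] by auto
      have "real (A i j0) * q j0 \<le> (\<Sum>l\<in>J. real (A i l) * q l)"
        using J j0 q0 by (intro member_le_sum[of j0 J "\<lambda>l. real (A i l) * q l"]) auto
      moreover have "real (A i j0) * q j0 > 0" using Aj qj0 by simp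
      ultimately have "r * q i > 0" using qeig[OF i] by linarith
      then show ?thesis using r0 by (simp add: zero_less_mult_iff)
    qed (use qj0 in simp)
    have other: "e i w = 0" if w: "w \<in> W" "w \<noteq> 1" for w
    proof (rule ccontr)
      assume "e i w \<noteq> 0"
      then have "w = 1"
        by (intro transitive_peripheral_eigenvalue[OF J trans r0 W(3)[OF w(1)] _ qeig eig i])
           (use dom w q_def in auto)
      then show False using w by simp
    qed
    have "e i 1 = of_real (q i)"
    proof -
      have "norm (e i 1) \<le> Re (e i 1)" using dom[OF i W(2)] .
      then have "Im (e i 1) = 0"
        using cmod_power2[of "e i 1"] power_mono[of "norm (e i 1)" "Re (e i 1)" 2]
          zero_le_power2[of "Im (e i 1)"] by simp
      then show ?thesis by (simp add: complex_eq_iff q_def)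
    qed
    then have "S i k = of_real (q i)" for k
      unfolding S_def using W(1,2) other by (subst sum.remove[of W 1]) auto
    then have "(\<lambda>k. complex_of_real (z i k - q i)) \<longlonglongrightarrow> complex_of_real 0"
      using asym[OF i] by simp
    then have "(\<lambda>k. z i k - q i) \<longlonglongrightarrow> 0" by (simp only: tendsto_of_real_iff)
    then have "z i \<longlonglongrightarrow> q i" by (simp add: LIM_zero_iff)
    then have "growth (\<lambda>k. V k i) r D (q i)" using r0 qi unfolding growth_def z_def by simp
    then show ?thesis by blast
  qed
qed

definition regular_growth :: "(nat \<Rightarrow> nat) \<Rightarrow> bool" where
  "regular_growth x \<longleftrightarrow> (\<forall>\<^sub>F k in sequentially. x k = 0) \<or> (\<exists>r D C. growth x r D C)"

text \<open>The set \<open>J\<close> of \<open>i\<close> and its successors is closed under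
  successors by transitivity, so the recurrence restricts to \<open>J\<close>, where
  \<open>i\<close> is a root.\<close>

lemma linear_system_transitive_growth:
  assumes sys: "linear_system I A V" and i: "i \<in> I"
    and trans: "\<And>i j l. i \<in> I \<Longrightarrow> j \<in> I \<Longrightarrow> l \<in> I \<Longrightarrow> A i j > 0 \<Longrightarrow> A j l > 0 \<Longrightarrow> A i l > 0"
  shows "regular_growth (\<lambda>k. V k i)"
proof -
  define J where "J = insert i {j\<in>I. A i j > 0}"
  have I: "finite I" and JI: "J \<subseteq> I" using sys i by (auto simp: linear_system_def J_def)
  have out: "A j l = 0" if "j \<in> J" "l \<in> I - J" for j l
    using that trans[of i j l] i by (fastforce simp: J_def)
  have "V (Suc k) j = (\<Sum>l\<in>J. A j l * V k l)" if j: "j \<in> J" for j k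
  proof -
    have "V (Suc k) j = (\<Sum>l\<in>I. A j l * V k l)" using sys j JI by (auto simp: linear_system_def)
    also have "\<dots> = (\<Sum>l\<in>J. A j l * V k l)"
      using I JI out[OF j] by (intro sum.mono_neutral_right) auto
    finally show ?thesis .
  qed
  then have "linear_system J A V" using I JI finite_subset by (auto simp: linear_system_def)
  then show ?thesis unfolding regular_growth_def
  proof (rule linear_system_rooted_growth)
    show "i \<in> J" by (simp add: J_def)
    show "j = i \<or> A i j > 0" if "j \<in> J" for j using that by (auto simp: J_def)
    show "A j m > 0" if "j \<in> J" "l \<in> J" "m \<in> J" "A j l > 0" "A l m > 0" for j l m
      using that JI trans[of j l m] by blast
  qed
qed

section \<open>Powers of the matrix and their support\<close>

primrec mat_pow :: "'a set \<Rightarrow> ('a \<Rightarrow> 'a \<Rightarrow> nat) \<Rightarrow> nat \<Rightarrow> 'a \<Rightarrow> 'a \<Rightarrow> nat" where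
  "mat_pow I A 0 i j = (if i = j then 1 else 0)"
| "mat_pow I A (Suc n) i j = (\<Sum>l\<in>I. A i l * mat_pow I A n l j)"

lemma linear_system_mat_pow:
  assumes "linear_system I A V" "i \<in> I"
  shows "V (n + k) i = (\<Sum>j\<in>I. mat_pow I A n i j * V k j)"
  using assms(2)
proof (induction n arbitrary: i)
  case 0
  then show ?case using assms(1) by (simp add: linear_system_def if_distrib[of "\<lambda>x. x * _"] cong: if_cong)
next
  case (Suc n)
  have "V (Suc n + k) i = (\<Sum>l\<in>I. A i l * V (n + k) l)"
    using assms(1) Suc.prems by (simp add: linear_system_def)
  also have "\<dots> = (\<Sum>l\<in>I. \<Sum>j\<in>I. A i l * mat_pow I A n l j * V k j)"
    using Suc.IH by (simp add: sum_distrib_left mult.assoc)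
  also have "\<dots> = (\<Sum>j\<in>I. mat_pow I A (Suc n) i j * V k j)"
    by (subst sum.swap) (simp add: sum_distrib_right)
  finally show ?case .
qed

lemma mat_pow_pos_iff:
  assumes "finite I" "i \<in> I" "j \<in> I"
  shows "mat_pow I A n i j > 0 \<longleftrightarrow> (i, j) \<in> {(i, j). i \<in> I \<and> j \<in> I \<and> A i j > 0} ^^ n"
  using assms(2)
proof (induction n arbitrary: i)
  case 0
  then show ?case by simp
next
  case (Suc n)
  let ?R = "{(i, j). i \<in> I \<and> j \<in> I \<and> A i j > 0}"
  have "mat_pow I A (Suc n) i j > 0 \<longleftrightarrow> (\<exists>l\<in>I. A i l > 0 \<and> mat_pow I A n l j > 0)"
    using assms(1) by (auto simp: sum_pos2 simp del: neq0_conv simp flip: neq0_conv)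
  also have "\<dots> \<longleftrightarrow> (\<exists>l. (i, l) \<in> ?R \<and> (l, j) \<in> ?R ^^ n)"
    using Suc by auto
  also have "\<dots> \<longleftrightarrow> (i, j) \<in> ?R ^^ Suc n"
    unfolding relpow.simps(2) relpow_commute[symmetric] by blast
  finally show ?case .
qed

text \<open>The positive powers of \<open>R\<close> take finitely many values, so from some index on
  they are periodic. An exponent that lies past this index and is a multiple of the period is
  idempotent.\<close>

lemma finite_relation_idempotent_power:
  fixes R :: "('a \<times> 'a) set"
  assumes "finite R"
  shows "\<exists>q>0. R ^^ (q + q) = R ^^ q"
proof -
  have sub: "R ^^ Suc n \<subseteq> Field R \<times> Field R" for n
    by (induction n) (auto simp: Field_def)
  then have "range (\<lambda>n. R ^^ Suc n) \<subseteq> Pow (Field R \<times> Field R)" by blast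
  moreover have "finite (Pow (Field R \<times> Field R))" using assms by (simp add: finite_Field)
  ultimately have "finite (range (\<lambda>n. R ^^ Suc n))" using finite_subset by blast
  then have "\<not> inj (\<lambda>n. R ^^ Suc n)" using finite_imageD infinite_UNIV_nat by blast
  then obtain a b where ab: "a < b" "R ^^ Suc a = R ^^ Suc b"
    unfolding inj_def by (metis nat_neq_iff)
  define t where "t = b - a"
  have t: "t > 0" "R ^^ (Suc a + t) = R ^^ Suc a" using ab by (auto simp: t_def simp del: relpow.simps)
  have step: "R ^^ (m + t) = R ^^ m" if "m \<ge> Suc a" for m
  proof -
    have "R ^^ (m + t) = R ^^ (m - Suc a) O R ^^ (Suc a + t)"
      using that by (subst relpow_add[symmetric]) simp
    also have "\<dots> = R ^^ m" unfolding t(2) using that by (subst relpow_add[symmetric]) simp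
    finally show ?thesis .
  qed
  have mult: "R ^^ (m + s * t) = R ^^ m" if "m \<ge> Suc a" for m s
  proof (induction s)
    case (Suc s)
    have "R ^^ (m + Suc s * t) = R ^^ ((m + s * t) + t)" by (simp add: algebra_simps)
    also have "\<dots> = R ^^ m" using step[of "m + s * t"] that Suc by simp
    finally show ?case .
  qed simp
  \<comment> \<open>The exponent \<open>Suc a * t\<close> is a multiple of the period
    \<open>t\<close> and at least the preperiod \<open>Suc a\<close>.\<close>
  have "Suc a * 1 \<le> Suc a * t" using t(1) by (intro mult_le_mono) auto
  then show ?thesis using mult[of "Suc a * t" "Suc a"] t(1) by (intro exI[of _ "Suc a * t"]) auto
qed

text \<open>With \<open>q\<close> an exponent for which the support of the matrix is idempotent, the
  support of the \<open>q\<close>-th power is transitive. The same \<open>q\<close> serves every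
  residue class \<open>s\<close>.\<close>

lemma linear_system_eventually_regular:
  assumes sys: "linear_system I A V"
  shows "\<exists>q>0. \<forall>s. \<exists>B. linear_system I B (\<lambda>k. V (q * k + s)) \<and> (\<forall>i\<in>I. regular_growth (\<lambda>k. V (q * k + s) i))"
proof -
  define R where "R = {(i, j). i \<in> I \<and> j \<in> I \<and> A i j > 0}"
  have I: "finite I" using sys by (simp add: linear_system_def)
  have "R \<subseteq> I \<times> I" by (auto simp: R_def)
  then have "finite R" using I finite_subset by blast
  then obtain q where q: "q > 0" "R ^^ (q + q) = R ^^ q" using finite_relation_idempotent_power by blast
  define B where "B = mat_pow I A q"
  have pos: "B i j > 0 \<longleftrightarrow> (i, j) \<in> R ^^ q" if "i \<in> I" "j \<in> I" for i j
    unfolding B_def R_def using mat_pow_pos_iff[OF I that] .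
  have trans: "B i l > 0" if "i \<in> I" "j \<in> I" "l \<in> I" "B i j > 0" "B j l > 0" for i j l
  proof -
    have "(i, l) \<in> R ^^ q O R ^^ q" using that pos by auto
    then have "(i, l) \<in> R ^^ q" using q(2) relpow_add[of q q R] by simp
    then show ?thesis using that pos by simp
  qed
  have lin: "linear_system I B (\<lambda>k. V (q * k + s))" for s
    unfolding linear_system_def B_def
  proof (intro conjI ballI allI I)
    fix i k assume "i \<in> I"
    from linear_system_mat_pow[OF sys this, of q "q * k + s"]
    show "V (q * Suc k + s) i = (\<Sum>j\<in>I. mat_pow I A q i j * V (q * k + s) j)"
      by (simp add: add_ac)
  qed
  show ?thesis
    by (intro exI[of _ q] conjI allI exI[of _ B] ballI lin q(1) linear_system_transitive_growth[OF lin _ trans])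
qed

section \<open>Sums of sequences with regular growth\<close>

lemma growth_smaller_tendsto_0:
  assumes "growth y s E C" "r > 0" "s < r \<or> (s = r \<and> E < D)"
  shows "(\<lambda>k. real (y k) / (real (k choose D) * r ^ k)) \<longlonglongrightarrow> 0"
proof -
  have s: "s > 0" and lim: "(\<lambda>k. real (y k) / (real (k choose E) * s ^ k)) \<longlonglongrightarrow> C"
    using assms(1) by (auto simp: growth_def)
  have "(\<lambda>k. real (k choose E) * (s / r) ^ k / real (k choose D)) \<longlonglongrightarrow> 0"
    using assms(2,3) s by (intro binomial_geometric_ratio_tendsto_0) auto
  from tendsto_mult[OF lim this]
  have "(\<lambda>k. real (y k) / (real (k choose E) * s ^ k) * (real (k choose E) * (s / r) ^ k / real (k choose D))) \<longlonglongrightarrow> 0"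
    by simp
  then show ?thesis
  proof (rule Lim_transform_eventually)
    show "\<forall>\<^sub>F k in sequentially. real (y k) / (real (k choose E) * s ^ k) * (real (k choose E) * (s / r) ^ k / real (k choose D))
       = real (y k) / (real (k choose D) * r ^ k)"
      using eventually_ge_at_top[of E]
    proof eventually_elim
      case (elim k)
      then have "real (k choose E) > 0" by simp
      then show ?case using s assms(2) by (simp add: power_divide divide_simps)
    qed
  qed
qed

lemma growth_add_smaller:
  assumes "growth x r D C" "growth y s E C'" "s < r \<or> (s = r \<and> E < D)"
  shows "growth (\<lambda>k. x k + y k) r D C"
proof -
  have r: "r > 0" "C > 0" and lim: "(\<lambda>k. real (x k) / (real (k choose D) * r ^ k)) \<longlonglongrightarrow> C"
    using assms(1) by (auto simp: growth_def)
  from tendsto_add[OF lim growth_smaller_tendsto_0[OF assms(2) r(1) assms(3)]] r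
  show ?thesis by (simp add: growth_def add_divide_distrib)
qed

lemma growth_cong:
  assumes "growth y r D C" "\<forall>\<^sub>F k in sequentially. x k = y k"
  shows "growth x r D C"
proof -
  have "(\<lambda>k. real (x k) / (real (k choose D) * r ^ k)) \<longlonglongrightarrow> C"
  proof (rule Lim_transform_eventually)
    show "(\<lambda>k. real (y k) / (real (k choose D) * r ^ k)) \<longlonglongrightarrow> C" using assms(1) by (simp add: growth_def)
    show "\<forall>\<^sub>F k in sequentially. real (y k) / (real (k choose D) * r ^ k) = real (x k) / (real (k choose D) * r ^ k)"
      using assms(2) by eventually_elim simp
  qed
  then show ?thesis using assms(1) by (simp add: growth_def)
qed

text \<open>The lexicographically larger pair of rate and degree wins. For equal pairs the constants
  add up, and being positive they cannot cancel.\<close>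

lemma regular_growth_add:
  assumes "regular_growth x" "regular_growth y"
  shows "regular_growth (\<lambda>k. x k + y k)"
proof (cases "(\<forall>\<^sub>F k in sequentially. x k = 0) \<or> (\<forall>\<^sub>F k in sequentially. y k = 0)")
  case True
  have *: "regular_growth (\<lambda>k. u k + v k)" if "\<forall>\<^sub>F k in sequentially. u k = 0" "regular_growth v" for u v :: "nat \<Rightarrow> nat"
    using that(2) unfolding regular_growth_def
  proof
    assume "\<forall>\<^sub>F k in sequentially. v k = 0"
    with that(1) have "\<forall>\<^sub>F k in sequentially. u k + v k = 0" by eventually_elim simp
    then show "(\<forall>\<^sub>F k in sequentially. u k + v k = 0) \<or> (\<exists>r D C. growth (\<lambda>k. u k + v k) r D C)" ..
  next
    assume "\<exists>r D C. growth v r D C"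
    then obtain r D C where g: "growth v r D C" by blast
    have "\<forall>\<^sub>F k in sequentially. u k + v k = v k" using that(1) by eventually_elim simp
    then show "(\<forall>\<^sub>F k in sequentially. u k + v k = 0) \<or> (\<exists>r D C. growth (\<lambda>k. u k + v k) r D C)"
      using growth_cong[OF g, of "\<lambda>k. u k + v k"] by blast
  qed
  from True show ?thesis
  proof
    assume "\<forall>\<^sub>F k in sequentially. x k = 0" then show ?thesis using * assms by blast
  next
    assume "\<forall>\<^sub>F k in sequentially. y k = 0"
    from *[OF this assms(1)] show ?thesis by (simp add: add.commute)
  qed
next
  case False
  then obtain r D C s E C' where g: "growth x r D C" "growth y s E C'"
    using assms by (auto simp: regular_growth_def)
  consider "r = s \<and> D = E" | "s < r \<or> (s = r \<and> E < D)" | "r < s \<or> (r = s \<and> D < E)" by linarith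
  then have "\<exists>r D C. growth (\<lambda>k. x k + y k) r D C"
  proof cases
    case 1
    then have "growth (\<lambda>k. x k + y k) r D (C + C')"
      using g by (auto simp: growth_def add_divide_distrib intro!: tendsto_add)
    then show ?thesis by blast
  next
    case 2 then show ?thesis using growth_add_smaller[OF g] by blast
  next
    case 3
    from growth_add_smaller[OF g(2,1) this] show ?thesis by (auto simp: add.commute)
  qed
  then show ?thesis by (simp add: regular_growth_def)
qed

lemma regular_growth_0: "regular_growth (\<lambda>_. 0)"
  by (simp add: regular_growth_def)

lemma regular_growth_mult: "regular_growth x \<Longrightarrow> regular_growth (\<lambda>k. n * x k)"
  by (induction n) (auto intro: regular_growth_0 regular_growth_add)

lemma regular_growth_sum:
  "finite S \<Longrightarrow> (\<And>i. i \<in> S \<Longrightarrow> regular_growth (x i)) \<Longrightarrow> regular_growth (\<lambda>k. \<Sum>i\<in>S. x i k)"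
  by (induction S rule: finite_induct) (auto intro: regular_growth_0 regular_growth_add)

section \<open>Leading coefficients and subfields\<close>

text \<open>As \<open>x / 0 = 0\<close> and \<open>0 = 1 - 1\<close> lies in the set, closure under
  division can be stated without a side condition.\<close>

definition real_subfield :: "real set \<Rightarrow> bool" where
  "real_subfield K \<longleftrightarrow> 1 \<in> K \<and> (\<forall>x\<in>K. \<forall>y\<in>K. x - y \<in> K \<and> x * y \<in> K \<and> x / y \<in> K)"

context
  fixes K :: "real set"
  assumes K: "real_subfield K"
begin

lemma real_subfield_1: "1 \<in> K" and real_subfield_diff: "x \<in> K \<Longrightarrow> y \<in> K \<Longrightarrow> x - y \<in> K"
  and real_subfield_mult: "x \<in> K \<Longrightarrow> y \<in> K \<Longrightarrow> x * y \<in> K"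
  and real_subfield_divide: "x \<in> K \<Longrightarrow> y \<in> K \<Longrightarrow> x / y \<in> K"
  using K by (auto simp: real_subfield_def)

lemma real_subfield_0: "0 \<in> K"
  using real_subfield_diff[OF real_subfield_1 real_subfield_1] by simp

lemma real_subfield_minus: "x \<in> K \<Longrightarrow> - x \<in> K"
  using real_subfield_diff[OF real_subfield_0, of x] by simp

lemma real_subfield_add: "x \<in> K \<Longrightarrow> y \<in> K \<Longrightarrow> x + y \<in> K"
  using real_subfield_diff[of x "- y"] real_subfield_minus[of y] by simp

lemma real_subfield_sum: "(\<And>i. i \<in> S \<Longrightarrow> f i \<in> K) \<Longrightarrow> sum f S \<in> K"
  by (induction S rule: infinite_finite_induct) (auto intro: real_subfield_0 real_subfield_add)

lemma real_subfield_of_nat: "of_nat n \<in> K"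
  by (induction n) (auto intro: real_subfield_0 real_subfield_1 real_subfield_add)

lemma real_subfield_of_int: "of_int n \<in> K"
  by (cases n rule: int_cases2) (auto intro: real_subfield_of_nat real_subfield_minus)

lemma real_subfield_of_rat: "of_rat c \<in> K"
  by (cases c) (auto simp: of_rat_rat intro: real_subfield_of_int real_subfield_divide)

text \<open>Synthetic division from the top: each coefficient of \<open>q\<close> is a coefficient
  of \<open>p\<close> plus \<open>l\<close> times the next higher coefficient of
  \<open>q\<close>.\<close>

lemma real_subfield_linear_factor:
  assumes "p = [:- l, 1:] * q" "l \<in> K" "\<And>i. coeff p i \<in> K"
  shows "coeff q i \<in> K"
proof (induction "Suc (degree q) - i" arbitrary: i)
  case 0
  then have "coeff q i = 0" by (intro coeff_eq_0) simp
  then show ?case using real_subfield_0 by simp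
next
  case (Suc d)
  have "coeff p (Suc i) = coeff q i - l * coeff q (Suc i)" using assms(1) by simp
  then have "coeff q i = coeff p (Suc i) + l * coeff q (Suc i)" by simp
  moreover have "coeff q (Suc i) \<in> K" using Suc by (intro Suc.hyps(1)) simp
  ultimately show ?case using assms(2,3) by (auto intro: real_subfield_add real_subfield_mult)
qed

lemma real_subfield_linear_factor_power:
  assumes "p = [:- l, 1:] ^ m * q" "l \<in> K" "\<And>i. coeff p i \<in> K"
  shows "coeff q i \<in> K"
  using assms
proof (induction m arbitrary: p i)
  case 0
  then show ?case by simp
next
  case (Suc m)
  have p: "p = [:- l, 1:] * ([:- l, 1:] ^ m * q)" using Suc.prems(1) by (simp only: power_Suc mult.assoc)
  show ?case
    by (rule Suc.IH[OF refl Suc.prems(2)]) (rule real_subfield_linear_factor[OF p Suc.prems(2,3)])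
qed

text \<open>The Newton coefficients arise from initial values and \<open>l\<close> by field
  operations, so they remain in \<open>K\<close>. The induction strips one factor by passing to
  \<open>v k = u (Suc k) - l * u k\<close>.\<close>

lemma real_subfield_newton_form:
  assumes "l \<in> K" "l \<noteq> 0" "\<And>k. u k \<in> K" "\<And>k. shift_act ([:- l, 1:] ^ m) u k = 0"
  shows "\<exists>a. (\<forall>i. a i \<in> K) \<and> (\<forall>k. u k = l ^ k * (\<Sum>i<m. a i * of_nat (k choose i)))"
  using assms(3,4)
proof (induction m arbitrary: u)
  case 0
  then show ?case by (auto intro!: exI[of _ "\<lambda>_. 0"] real_subfield_0)
next
  case (Suc m)
  define v where "v = shift_act [:- l, 1:] u"
  have v: "v k = u (Suc k) - l * u k" for k by (simp add: v_def flip: one_pCons)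
  have "v k \<in> K" for k unfolding v using Suc.prems(1) assms(1)
    by (auto intro: real_subfield_diff real_subfield_mult)
  moreover have "shift_act ([:- l, 1:] ^ m) v k = 0" for k
    using Suc.prems(2)[of k] unfolding v_def power_Suc2 shift_act_mult .
  ultimately obtain b where b: "\<And>i. b i \<in> K" "\<And>k. v k = l ^ k * (\<Sum>i<m. b i * of_nat (k choose i))"
    using Suc.IH[of v] by blast
  \<comment> \<open>The difference \<open>u (Suc k) / l ^ Suc k - u k / l ^ k\<close> equals
    \<open>v k / l ^ Suc k\<close>; summing it raises each binomial by one degree and divides by
    \<open>l\<close>.\<close>
  define a where "a i = (case i of 0 \<Rightarrow> u 0 | Suc i \<Rightarrow> b i / l)" for i
  have "a i \<in> K" for i
    using b(1) assms(1) Suc.prems(1) by (auto simp: a_def split: nat.splits intro: real_subfield_divide)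
  moreover have "u k = l ^ k * (\<Sum>i<Suc m. a i * of_nat (k choose i))" for k
  proof (induction k)
    case 0
    have "(\<Sum>i<Suc m. a i * of_nat (0 choose i)) = a 0"
      by (subst sum.lessThan_Suc_shift) simp
    then show ?case by (simp add: a_def)
  next
    case (Suc k)
    have "(\<Sum>i<Suc m. a i * of_nat (Suc k choose i))
        = (\<Sum>i<Suc m. a i * of_nat (k choose i)) + (\<Sum>i<m. a (Suc i) * of_nat (k choose i))"
      unfolding sum.lessThan_Suc_shift by (simp add: algebra_simps sum.distrib)
    also have "(\<Sum>i<m. a (Suc i) * of_nat (k choose i)) = (\<Sum>i<m. b i * of_nat (k choose i)) / l"
      by (simp add: a_def sum_divide_distrib)
    finally have "l ^ Suc k * (\<Sum>i<Suc m. a i * of_nat (Suc k choose i)) = l * u k + v k"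
      using Suc assms(2) b(2)[of k] by (simp add: algebra_simps)
    then show ?case using v[of k] by simp
  qed
  ultimately show ?case by blast
qed

text \<open>The sum grows like its last nonzero term, of index \<open>M\<close>. A finite limit
  excludes \<open>D < M\<close>; for \<open>D >= M\<close> the limit is the coefficient of index
  \<open>D\<close>, or 0 if there is none.\<close>

lemma real_subfield_leading_coeff:
  assumes "\<And>i. a i \<in> K"
    and lim: "(\<lambda>k. (\<Sum>i<m. a i * real (k choose i)) / real (k choose D)) \<longlonglongrightarrow> c"
  shows "c \<in> K"
proof (cases "\<exists>i<m. a i \<noteq> 0")
  case False
  then have "(\<lambda>k. (\<Sum>i<m. a i * real (k choose i)) / real (k choose D)) = (\<lambda>_. 0)" by auto
  then have "c = 0" using lim by (simp add: LIMSEQ_const_iff)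
  then show ?thesis by (simp add: real_subfield_0)
next
  case True
  define M where "M = Max {i. i < m \<and> a i \<noteq> 0}"
  have fin: "finite {i. i < m \<and> a i \<noteq> 0}" by simp
  have "M \<in> {i. i < m \<and> a i \<noteq> 0}" unfolding M_def using True fin by (intro Max_in) auto
  then have M: "M < m" "a M \<noteq> 0" by auto
  have M_max: "i \<le> M" if "i < m" "a i \<noteq> 0" for i unfolding M_def using that by (intro Max_ge) auto
  have ratio: "(\<lambda>k. a i * real (k choose i) / real (k choose N)) \<longlonglongrightarrow> 0" if "i < N" for i N
    using tendsto_mult_right_zero[OF binomial_geometric_ratio_tendsto_0[of 1 i N], of "a i"] that by simp
  have self: "(\<lambda>k. a i * real (k choose i) / real (k choose i)) \<longlonglongrightarrow> a i" for i
  proof (rule Lim_transform_eventually[OF tendsto_const])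
    show "\<forall>\<^sub>F k in sequentially. a i = a i * real (k choose i) / real (k choose i)"
      using eventually_ge_at_top[of i] by eventually_elim simp
  qed
  have summand: "(\<lambda>k. a i * real (k choose i) / real (k choose N)) \<longlonglongrightarrow> (if i = N then a i else 0)"
    if iN: "i < m" "N \<ge> M" for i N
  proof -
    consider "a i = 0" | "i < N" | "i = N" using M_max[of i] iN by fastforce
    then show ?thesis by cases (use ratio[of i N] self in auto)
  qed
  have limN: "(\<lambda>k. (\<Sum>i<m. a i * real (k choose i)) / real (k choose N)) \<longlonglongrightarrow> (if N < m then a N else 0)"
    if "N \<ge> M" for N
  proof -
    have "(\<lambda>k. (\<Sum>i<m. a i * real (k choose i) / real (k choose N))) \<longlonglongrightarrow> (\<Sum>i<m. if i = N then a i else 0)"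
      by (intro tendsto_sum summand that) auto
    then show ?thesis by (simp add: sum_divide_distrib)
  qed
  have "D \<ge> M"
  proof (rule ccontr)
    assume "\<not> D \<ge> M"
    then have "(\<lambda>k. real (k choose D) * 1 ^ k / real (k choose M)) \<longlonglongrightarrow> 0"
      by (intro binomial_geometric_ratio_tendsto_0) auto
    from tendsto_mult[OF lim this]
    have "(\<lambda>k. (\<Sum>i<m. a i * real (k choose i)) / real (k choose D) * (real (k choose D) * 1 ^ k / real (k choose M))) \<longlonglongrightarrow> 0" by simp
    then have "(\<lambda>k. (\<Sum>i<m. a i * real (k choose i)) / real (k choose M)) \<longlonglongrightarrow> 0"
    proof (rule Lim_transform_eventually)
      show "\<forall>\<^sub>F k in sequentially. (\<Sum>i<m. a i * real (k choose i)) / real (k choose D) * (real (k choose D) * 1 ^ k / real (k choose M))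
        = (\<Sum>i<m. a i * real (k choose i)) / real (k choose M)"
        using eventually_ge_at_top[of D] by eventually_elim simp
    qed
    then have "(if M < m then a M else 0) = 0" using limN[of M] LIMSEQ_unique by blast
    then show False using M by simp
  qed
  then have "c = (if D < m then a D else 0)" using limN[of D] lim LIMSEQ_unique by blast
  then show ?thesis using assms(1) real_subfield_0 by simp
qed

end

section \<open>Growth rate and growth constant of a recurrent sequence\<close>

lemma growth_shift_act:
  assumes "growth x r D C"
  shows "(\<lambda>k. shift_act p (\<lambda>k. real (x k)) k / (real (k choose D) * r ^ k)) \<longlonglongrightarrow> C * poly p r"
proof (induction p)
  case 0
  then show ?case by simp
next
  case (pCons a p)
  have r: "r > 0" and lim: "(\<lambda>k. real (x k) / (real (k choose D) * r ^ k)) \<longlonglongrightarrow> C"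
    using assms by (auto simp: growth_def)
  define b where "b k = real (Suc k choose D) / real (k choose D)" for k
  have b: "b \<longlonglongrightarrow> 1" unfolding b_def by (rule binomial_Suc_ratio_tendsto_1)
  define y where "y = (\<lambda>k. shift_act p (\<lambda>k. real (x k)) k)"
  have y: "(\<lambda>k. y (Suc k) / (real (Suc k choose D) * r ^ Suc k)) \<longlonglongrightarrow> C * poly p r"
    using LIMSEQ_Suc[OF pCons.IH] by (simp add: y_def)
  have "(\<lambda>k. a * (real (x k) / (real (k choose D) * r ^ k)) + r * (b k * (y (Suc k) / (real (Suc k choose D) * r ^ Suc k))))
      \<longlonglongrightarrow> a * C + r * (1 * (C * poly p r))"
    by (intro tendsto_intros lim b y)
  then have "(\<lambda>k. a * (real (x k) / (real (k choose D) * r ^ k)) + r * (b k * (y (Suc k) / (real (Suc k choose D) * r ^ Suc k))))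
      \<longlonglongrightarrow> C * poly (pCons a p) r"
    by (simp add: algebra_simps)
  then show ?case
  proof (rule Lim_transform_eventually)
    show "\<forall>\<^sub>F k in sequentially. a * (real (x k) / (real (k choose D) * r ^ k)) + r * (b k * (y (Suc k) / (real (Suc k choose D) * r ^ Suc k)))
       = shift_act (pCons a p) (\<lambda>k. real (x k)) k / (real (k choose D) * r ^ k)"
      using eventually_ge_at_top[of D]
    proof eventually_elim
      case (elim k)
      define B where "B = real (Suc k choose D)"
      have pos: "real (k choose D) > 0" "B > 0" using elim by (auto simp: B_def simp del: binomial_Suc_Suc)
      have "r * (b k * (y (Suc k) / (real (Suc k choose D) * r ^ Suc k))) = y (Suc k) / (real (k choose D) * r ^ k)"
        unfolding b_def B_def[symmetric] using pos r by (simp add: divide_simps)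
      then show ?case by (simp add: y_def add_divide_distrib)
    qed
  qed
qed

text \<open>Split \<open>p\<close> into a power of \<open>X - r\<close> and a cofactor
  \<open>q\<close> with \<open>poly q r\<close> nonzero. The sequence obtained by applying
  \<open>q\<close> is annihilated by that power, so it has a Newton form over \<open>K\<close>, and
  its leading coefficient is \<open>C * poly q r\<close>. Division by \<open>poly q r\<close> gives
  the claim.\<close>

lemma growth_constant_in_subfield:
  assumes K: "real_subfield K" and g: "growth x r D C" and r: "r \<in> K"
    and p: "p \<noteq> 0" "\<And>i. coeff p i \<in> K" "\<And>k. shift_act p (\<lambda>k. real (x k)) k = 0"
  shows "C \<in> K"
proof -
  have r0: "r > 0" and C0: "C > 0" using g by (auto simp: growth_def)
  obtain q where q: "p = [:- r, 1:] ^ order r p * q" "\<not> [:- r, 1:] dvd q"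
    using order_decomp[OF p(1)] by blast
  define m where "m = order r p"
  have qK: "coeff q i \<in> K" for i
    using real_subfield_linear_factor_power[OF K q(1) r p(2)] .
  have qr: "poly q r \<noteq> 0" using q(2) by (simp add: poly_eq_0_iff_dvd)
  have "poly q r = (\<Sum>i\<le>degree q. coeff q i * r ^ i)" by (simp add: poly_altdef)
  moreover have "r ^ i \<in> K" for i
    by (induction i) (auto intro: real_subfield_1[OF K] real_subfield_mult[OF K] r)
  ultimately have qrK: "poly q r \<in> K" using qK by (auto intro!: real_subfield_sum[OF K] real_subfield_mult[OF K])
  define u where "u = shift_act q (\<lambda>k. real (x k))"
  have "u k \<in> K" for k unfolding u_def shift_act_def
    by (intro real_subfield_sum[OF K] real_subfield_mult[OF K] qK real_subfield_of_nat[OF K])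
  moreover have "shift_act ([:- r, 1:] ^ m) u k = 0" for k
    using p(3)[of k] q(1) unfolding u_def m_def by (metis shift_act_mult)
  ultimately obtain a where a: "\<And>i. a i \<in> K" "\<And>k. u k = r ^ k * (\<Sum>i<m. a i * of_nat (k choose i))"
    using real_subfield_newton_form[OF K r, of u m] r0 by auto
  have "(\<lambda>k. u k / (real (k choose D) * r ^ k)) \<longlonglongrightarrow> C * poly q r"
    using growth_shift_act[OF g, of q] by (simp add: u_def)
  moreover have "u k / (real (k choose D) * r ^ k) = (\<Sum>i<m. a i * real (k choose i)) / real (k choose D)" for k
    using r0 by (simp add: a(2))
  ultimately have "C * poly q r \<in> K"
    using real_subfield_leading_coeff[OF K a(1)] by simp
  then have "C * poly q r / poly q r \<in> K" using qrK by (intro real_subfield_divide[OF K])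
  then show ?thesis using qr by simp
qed

text \<open>Applying \<open>p\<close> multiplies the growth constant by \<open>poly p r\<close>, and
  here the result is the zero sequence.\<close>

lemma growth_rate_root:
  assumes "growth x r D C" "\<And>k. shift_act p (\<lambda>k. real (x k)) k = 0"
  shows "poly p r = 0"
proof -
  have "(\<lambda>k. 0) \<longlonglongrightarrow> C * poly p r" using growth_shift_act[OF assms(1), of p] assms(2) by simp
  then have "C * poly p r = 0" by (simp add: LIMSEQ_const_iff)
  then show ?thesis using assms(1) by (simp add: growth_def)
qed

section \<open>The field generated by one real number over the rationals\<close>

context
  fixes l :: real
begin

definition rat_eval :: "rat poly \<Rightarrow> real" where
  "rat_eval p = poly (map_poly of_rat p) l"

lemma rat_eval_add: "rat_eval (p + q) = rat_eval p + rat_eval q"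
proof -
  have "map_poly of_rat (p + q) = map_poly of_rat p + (map_poly of_rat q :: real poly)"
    by (simp add: poly_eq_iff coeff_map_poly of_rat_add)
  then show ?thesis by (simp add: rat_eval_def)
qed

lemma rat_eval_mult: "rat_eval (p * q) = rat_eval p * rat_eval q"
proof -
  have "map_poly of_rat (p * q) = map_poly of_rat p * (map_poly of_rat q :: real poly)"
    by (simp add: poly_eq_iff coeff_map_poly coeff_mult of_rat_sum of_rat_mult)
  then show ?thesis by (simp add: rat_eval_def)
qed

lemma rat_eval_simps: "rat_eval 0 = 0" "rat_eval 1 = 1" "rat_eval [:c:] = of_rat c" "rat_eval [:0, 1:] = l"
  by (simp_all add: rat_eval_def map_poly_pCons)

lemma rat_eval_diff: "rat_eval (p - q) = rat_eval p - rat_eval q"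
  using rat_eval_add[of "p - q" q] by simp

lemma rat_eval_power: "rat_eval (p ^ n) = rat_eval p ^ n"
  by (induction n) (simp_all add: rat_eval_simps rat_eval_mult)

lemma rat_eval_smult: "rat_eval (smult c p) = of_rat c * rat_eval p"
  using rat_eval_mult[of "[:c:]" p] by (simp add: rat_eval_simps)

lemma rat_eval_sum: "rat_eval (sum f S) = (\<Sum>i\<in>S. rat_eval (f i))"
  by (induction S rule: infinite_finite_induct) (simp_all add: rat_eval_simps rat_eval_add)

lemma real_subfield_rat_eval:
  "real_subfield {rat_eval a / rat_eval b | a b. rat_eval b \<noteq> 0}" (is "real_subfield ?K")
proof -
  \<comment> \<open>If the denominator evaluates to 0, the quotient is 0 by convention and equals
    \<open>0 / 1\<close>; this covers division by a zero element.\<close>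
  have I: "rat_eval a / rat_eval b \<in> ?K" for a b
  proof (cases "rat_eval b = 0")
    case True
    then have "rat_eval a / rat_eval b = rat_eval 0 / rat_eval 1" by (simp add: rat_eval_simps)
    moreover have "rat_eval 1 \<noteq> 0" by (simp add: rat_eval_simps)
    ultimately show ?thesis by blast
  qed blast
  have "x - y \<in> ?K \<and> x * y \<in> ?K \<and> x / y \<in> ?K" if xy: "x \<in> ?K" "y \<in> ?K" for x y
  proof -
    obtain a b where x: "x = rat_eval a / rat_eval b" "rat_eval b \<noteq> 0" using xy(1) by blast
    obtain c d where y: "y = rat_eval c / rat_eval d" "rat_eval d \<noteq> 0" using xy(2) by blast
    have 1: "x - y = rat_eval (a * d - c * b) / rat_eval (b * d)"
      using x y by (simp add: rat_eval_diff rat_eval_mult diff_frac_eq)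
    have 2: "x * y = rat_eval (a * c) / rat_eval (b * d)"
      using x y by (simp add: rat_eval_mult)
    have 3: "x / y = rat_eval (a * d) / rat_eval (b * c)"
      using x y by (simp add: rat_eval_mult)
    show ?thesis unfolding 1 2 3 by (intro conjI I)
  qed
  moreover have "1 \<in> ?K" using I[of 1 1] by (simp add: rat_eval_simps)
  ultimately show ?thesis unfolding real_subfield_def by blast
qed

text \<open>Reduced modulo \<open>p\<close>, the \<open>n + 1\<close> products
  \<open>a ^ i * b ^ (n - i)\<close> lie in the \<open>n\<close>-dimensional space of polynomials of
  degree below \<open>n\<close>. A rational dependence between them, evaluated and divided by the
  \<open>n\<close>-th power of the denominator, is an equation for the quotient.\<close>

lemma algebraic_rat_eval_quotient:
  assumes p: "p \<noteq> 0" "rat_eval p = 0" and b: "rat_eval b \<noteq> 0"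
  shows "algebraic (rat_eval a / rat_eval b)"
proof -
  define n where "n = degree p"
  have n: "n > 0"
  proof (rule ccontr)
    assume "\<not> n > 0"
    then obtain c where "p = [:c:]" by (metis n_def degree_eq_zeroE gr0I)
    then show False using p by (simp add: rat_eval_simps)
  qed
  define f where "f i = (a ^ i * b ^ (n - i)) mod p" for i
  have f_eval: "rat_eval (f i) = rat_eval a ^ i * rat_eval b ^ (n - i)" for i
  proof -
    have "rat_eval (a ^ i * b ^ (n - i)) = rat_eval (f i + p * ((a ^ i * b ^ (n - i)) div p))"
      by (simp add: f_def)
    then show ?thesis by (simp add: rat_eval_add rat_eval_mult rat_eval_power p(2))
  qed
  obtain c where c: "\<exists>i\<in>{..n}. c i \<noteq> 0" "\<forall>j\<in>{..<n}. (\<Sum>i\<le>n. c i * coeff (f i) j) = 0"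
    using linear_dependence_card[of "{..<n}" "{..n}" "\<lambda>i j. coeff (f i) j"] by auto
  have "(\<Sum>i\<le>n. smult (c i) (f i)) = 0"
  proof (rule poly_eqI)
    fix j
    show "coeff (\<Sum>i\<le>n. smult (c i) (f i)) j = coeff 0 j"
    proof (cases "j < n")
      case True
      then show ?thesis using c(2) by (simp add: coeff_sum)
    next
      case False
      have "coeff (f i) j = 0" for i
      proof (cases "f i = 0")
        case nz: False
        then have "degree (f i) < n" unfolding f_def n_def using p(1) degree_mod_less by blast
        then show ?thesis using False by (intro coeff_eq_0) simp
      qed simp
      then show ?thesis by (simp add: coeff_sum)
    qed
  qed
  then have "0 = rat_eval (\<Sum>i\<le>n. smult (c i) (f i))" by (simp add: rat_eval_simps)
  also have "\<dots> = (\<Sum>i\<le>n. of_rat (c i) * (rat_eval a ^ i * rat_eval b ^ (n - i)))"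
    by (simp add: rat_eval_sum rat_eval_smult f_eval)
  also have "\<dots> = rat_eval b ^ n * (\<Sum>i\<le>n. of_rat (c i) * (rat_eval a / rat_eval b) ^ i)"
    unfolding sum_distrib_left using b by (intro sum.cong) (auto simp: power_diff power_divide)
  finally have 0: "(\<Sum>i\<le>n. of_rat (c i) * (rat_eval a / rat_eval b) ^ i) = 0" using b by simp
  define P :: "real poly" where "P = (\<Sum>i\<le>n. monom (of_rat (c i)) i)"
  have cP: "coeff P j = (if j \<le> n then of_rat (c j) else 0)" for j by (auto simp: P_def coeff_sum)
  obtain i where "i \<le> n" "c i \<noteq> 0" using c(1) by blast
  then have "coeff P i \<noteq> 0" by (simp add: cP)
  then have "P \<noteq> 0" by auto
  moreover have "poly P (rat_eval a / rat_eval b) = 0"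
    using 0 by (simp add: P_def poly_sum poly_monom)
  moreover have "coeff P j \<in> \<rat>" for j by (simp add: cP)
  ultimately show ?thesis by (intro algebraicI'[of P]) auto
qed

end

lemma algebraic_subfield_exists:
  assumes "p \<noteq> 0" "poly (map_poly of_rat p) l = (0 :: real)"
  shows "\<exists>K. real_subfield K \<and> l \<in> K \<and> (\<forall>x\<in>K. algebraic x)"
proof (intro exI conjI ballI)
  let ?K = "{rat_eval l a / rat_eval l b | a b. rat_eval l b \<noteq> 0}"
  show "real_subfield ?K" by (rule real_subfield_rat_eval)
  have "l = rat_eval l [:0, 1:] / rat_eval l 1" by (simp add: rat_eval_simps)
  moreover have "rat_eval l 1 \<noteq> 0" by (simp add: rat_eval_simps)
  ultimately show "l \<in> ?K" by blast
  fix x assume "x \<in> ?K"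
  then show "algebraic x" using algebraic_rat_eval_quotient[of p l] assms by (auto simp: rat_eval_def)
qed

lemma real_subfield_Rats: "real_subfield \<rat>"
  by (auto simp: real_subfield_def)

section \<open>Prolongable morphisms and zero blocks\<close>

abbreviation hpow :: "(nat \<Rightarrow> nat list) \<Rightarrow> nat \<Rightarrow> nat list \<Rightarrow> nat list" where
  "hpow h n \<equiv> hom_ext h ^^ n"

lemma hom_ext_simps [simp]: "hom_ext h [] = []" "hom_ext h (c # y) = h c @ hom_ext h y"
  "hom_ext h (y @ z) = hom_ext h y @ hom_ext h z"
  by (auto simp: hom_ext_def)

lemma hpow_Nil [simp]: "hpow h n [] = []"
  by (induction n) auto

lemma hpow_append [simp]: "hpow h n (y @ z) = hpow h n y @ hpow h n z"
  by (induction n) auto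

lemma hpow_Cons: "hpow h n (c # y) = hpow h n [c] @ hpow h n y"
  using hpow_append[of n h "[c]" y] by simp

lemma hpow_Suc_singleton: "hpow h (Suc n) [c] = hpow h n (h c)"
  by (simp add: funpow_swap1[symmetric]) (simp add: funpow_swap1)

lemma hpow_add: "hpow h (m + n) y = hpow h m (hpow h n y)"
  by (simp add: funpow_add)

lemma set_hpow: "set (hpow h n y) = (\<Union>c\<in>set y. set (hpow h n [c]))"
proof (induction y)
  case (Cons c y)
  then show ?case by (subst hpow_Cons) simp
qed simp

lemma length_dropWhile_rev:
  assumes "0 < m" "m \<le> length y" "\<not> P (y ! (m - 1))" "\<And>t. m \<le> t \<Longrightarrow> t < length y \<Longrightarrow> P (y ! t)"
  shows "length (dropWhile P (rev y)) = m"
proof -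
  have y: "y = take m y @ drop m y" by simp
  have t: "take m y = take (m - 1) y @ [y ! (m - 1)]"
    using assms(1,2) by (cases m) (auto simp: take_Suc_conv_app_nth)
  have "\<forall>c\<in>set (rev (drop m y)). P c"
  proof
    fix c assume "c \<in> set (rev (drop m y))"
    then obtain k where "k < length y - m" "c = y ! (m + k)" by (auto simp: in_set_conv_nth)
    then show "P c" using assms(4)[of "m + k"] by simp
  qed
  then have "dropWhile P (rev (drop m y) @ rev (take m y)) = dropWhile P (rev (take m y))"
    by (intro dropWhile_append2) auto
  also have "\<dots> = rev (take m y)" unfolding t using assms(3) by simp
  also have "rev (drop m y) @ rev (take m y) = rev y" by (metis y rev_append)
  finally show ?thesis using assms(2) by simp
qed

lemma length_takeWhile_eq:
  assumes "m < length y" "\<not> P (y ! m)" "\<And>t. t < m \<Longrightarrow> P (y ! t)"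
  shows "length (takeWhile P y) = m"
  using takeWhile_eq_take_P_nth[of m y P] assms by simp

section \<open>The fixed point and the images of its letters\<close>

locale morphic =
  fixes Alph :: "nat set" and h :: "nat \<Rightarrow> nat list" and a :: nat and u :: "nat \<Rightarrow> nat" and \<tau> :: "nat \<Rightarrow> nat"
  assumes pm: "pure_morphic_word Alph h a u"
begin

lemma finite_Alph: "finite Alph" and a_Alph: "a \<in> Alph" and h_Alph: "c \<in> Alph \<Longrightarrow> set (h c) \<subseteq> Alph"
  using pm by (auto simp: pure_morphic_word_def)

definition x where "x = tl (h a)"

lemma h_a: "h a = a # x" and hpow_x_nonempty: "hpow h n x \<noteq> []"
proof -
  obtain y where y: "h a = a # y" "y \<noteq> []" "\<And>n. hpow h n y \<noteq> []"
    using pm unfolding pure_morphic_word_def by blast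
  then have "x = y" by (simp add: x_def)
  with y show "h a = a # x" "hpow h n x \<noteq> []" by auto
qed

lemma x_Alph: "set x \<subseteq> Alph"
  using h_Alph[OF a_Alph] h_a by simp

lemma hpow_Alph: "set y \<subseteq> Alph \<Longrightarrow> set (hpow h n y) \<subseteq> Alph"
proof (induction n)
  case (Suc n)
  then show ?case using h_Alph by (auto simp: hom_ext_def)
qed simp

definition E :: "nat \<Rightarrow> nat" where "E n = length (hpow h n [a])"

lemma hpow_a_Suc: "hpow h (Suc n) [a] = hpow h n [a] @ hpow h n x"
  unfolding hpow_Suc_singleton h_a by (rule hpow_Cons)

lemma E_Suc: "E (Suc n) = E n + length (hpow h n x)"
  by (simp only: E_def hpow_a_Suc length_append)

lemma E_0: "E 0 = 1" by (simp add: E_def)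

lemma E_less_Suc: "E n < E (Suc n)"
  using hpow_x_nonempty[of n] by (simp add: E_Suc)

lemma E_mono: "m \<le> n \<Longrightarrow> E m \<le> E n"
  by (rule lift_Suc_mono_le[of E]) (auto intro: less_imp_le[OF E_less_Suc])

lemma E_gt: "n < E n"
proof (induction n)
  case (Suc n)
  then show ?case using E_less_Suc[of n] by simp
qed (simp add: E_0)

definition U :: "nat \<Rightarrow> nat list" where "U P = map u [0..<P]"

lemma length_U [simp]: "length (U P) = P" and U_nth: "i < P \<Longrightarrow> U P ! i = u i"
  and take_U: "P \<le> Q \<Longrightarrow> take P (U Q) = U P" and U_Suc: "U (Suc P) = U P @ [u P]" and U_0: "U 0 = []"
  by (auto simp: U_def take_map)

lemma hpow_a: "hpow h n [a] = U (E n)"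
proof (rule nth_equalityI)
  fix i assume "i < length (hpow h n [a])"
  then show "hpow h n [a] ! i = U (E n) ! i"
    using pm by (simp add: pure_morphic_word_def U_nth E_def)
qed (simp add: E_def)

text \<open>The position in \<open>u\<close> where the \<open>n\<close>-th image of the letter at
  position \<open>P\<close> begins. These are the cut points of level \<open>n\<close>; two
  consecutive ones bound a cell.\<close>

definition N :: "nat \<Rightarrow> nat \<Rightarrow> nat" where "N n P = length (hpow h n (U P))"

text \<open>\<open>U P\<close> is a prefix of the \<open>P\<close>-th iterate of \<open>a\<close>,
  so its \<open>n\<close>-th image is a prefix of the \<open>(n + P)\<close>-th iterate, hence of
  \<open>u\<close>.\<close>

lemma hpow_U: "hpow h n (U P) = U (N n P)"
proof -
  have P: "P \<le> E P" using E_gt[of P] by simp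
  have "hpow h n (U (E P)) = U (E (n + P))"
    by (simp only: hpow_a[symmetric] hpow_add)
  moreover have "U (E P) = U P @ drop P (U (E P))"
    using take_U[OF P] append_take_drop_id[of P "U (E P)"] by simp
  ultimately have eq: "hpow h n (U P) @ hpow h n (drop P (U (E P))) = U (E (n + P))"
    by (metis hpow_append)
  then have "hpow h n (U P) = take (N n P) (U (E (n + P)))"
    by (metis N_def append_eq_conv_conj)
  moreover have "N n P \<le> E (n + P)" using arg_cong[OF eq, of length] by (simp add: N_def)
  ultimately show ?thesis by (simp add: take_U)
qed

lemma u_Alph: "u P \<in> Alph"
proof -
  have "P < E P" by (rule E_gt)
  then have "u P \<in> set (U (E P))" by (auto simp: U_def)
  then show ?thesis using hpow_Alph[of "[a]" P] a_Alph by (auto simp: hpow_a)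
qed

lemma N_Suc_right: "N n (Suc P) = N n P + length (hpow h n [u P])"
  by (simp add: N_def U_Suc)

lemma N_0_right: "N n 0 = 0" by (simp add: N_def U_0)

lemma N_0_left: "N 0 P = P" by (simp add: N_def)

lemma N_mono: "P \<le> Q \<Longrightarrow> N n P \<le> N n Q"
  by (rule lift_Suc_mono_le[of "N n"]) (auto simp: N_Suc_right)

lemma N_less_imp: "N n P < N n Q \<Longrightarrow> P < Q"
  using N_mono[of Q P n] by (meson not_less)

lemma N_Suc_left: "N (Suc n) P = N n (N 1 P)"
proof -
  have "hpow h (Suc n) (U P) = hpow h n (hpow h 1 (U P))" by (metis Suc_eq_plus1 hpow_add)
  also have "hpow h 1 (U P) = U (N 1 P)" by (rule hpow_U)
  finally show ?thesis unfolding N_def[of "Suc n"] N_def[of n] by (rule arg_cong)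
qed

lemma N_E: "N n (E t) = E (n + t)"
proof -
  have "hpow h n (U (E t)) = hpow h (n + t) [a]" by (simp only: hpow_a[of t, symmetric] hpow_add)
  then have "N n (E t) = length (hpow h (n + t) [a])" unfolding N_def by (rule arg_cong)
  then show ?thesis by (simp only: E_def)
qed

lemma N_1: "N n 1 = E n"
  using N_E[of n 0] by (simp add: E_0)

lemma N_sum: "N n P = (\<Sum>Q<P. length (hpow h n [u Q]))"
  by (induction P) (simp_all add: N_0_right N_Suc_right)

text \<open>Letters may have empty images, so cut points may coincide; taking the least
  \<open>M\<close> whose cut point exceeds \<open>t\<close> selects a nonempty cell.\<close>

lemma cell_exists: "\<exists>P. N n P \<le> t \<and> t < N n (Suc P)"
proof -
  have ex: "t < N n (E t)" using E_gt[of "n + t"] by (simp add: N_E)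
  define M where "M = (LEAST M. t < N n M)"
  have M: "t < N n M" unfolding M_def using ex by (rule LeastI)
  then have "M \<noteq> 0" by (metis N_0_right not_less0)
  then obtain P where P: "M = Suc P" by (cases M) auto
  have "\<not> t < N n P" using not_less_Least[of P "\<lambda>M. t < N n M"] P by (simp add: M_def)
  then show ?thesis using M P by (intro exI[of _ P]) auto
qed

lemma u_cell:
  assumes "k < length (hpow h n [u P])"
  shows "u (N n P + k) = hpow h n [u P] ! k"
proof -
  have "U (N n (Suc P)) = hpow h n (U P) @ hpow h n [u P]"
    by (simp only: hpow_U[symmetric] U_Suc hpow_append)
  then have "U (N n (Suc P)) ! (N n P + k) = hpow h n [u P] ! k"
    by (simp add: nth_append N_def)
  moreover have "N n P + k < N n (Suc P)" using assms by (simp add: N_Suc_right)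
  ultimately show ?thesis by (simp add: U_nth)
qed

section \<open>Zero blocks and the cells around their endpoints\<close>

definition zero :: "nat \<Rightarrow> bool" where "zero c \<longleftrightarrow> \<tau> c = 0"

definition lead :: "nat \<Rightarrow> nat \<Rightarrow> nat" where
  "lead n c = length (takeWhile zero (hpow h n [c]))"

text \<open>One more than the offset of the last nonzero letter, or 0 if there is none. Added to the
  beginning of a cell that has a nonzero letter, it gives the position where the zeros at its end
  would start.\<close>

definition trunc :: "nat \<Rightarrow> nat \<Rightarrow> nat" where
  "trunc n c = length (dropWhile zero (rev (hpow h n [c])))"

text \<open>A block starting at position 0 is left out: its ratio is meaningless and it does not
  affect the limsup.\<close>

definition block :: "nat \<Rightarrow> nat \<Rightarrow> bool" where
  "block i j \<longleftrightarrow> 1 \<le> i \<and> i \<le> j \<and> \<not> zero (u (i - 1)) \<and> (\<forall>t\<in>{i..j}. zero (u t)) \<and> \<not> zero (u (Suc j))"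

text \<open>Take the highest level at which some cut point \<^term>\<open>N n P\<close> still falls inside the block; one level up,
  the block lies inside the image of a single letter \<^term>\<open>u R\<close>.\<close>

lemma block_parameters:
  assumes "block i j"
  obtains n R Pc Pd where "Pc < Pd" "Pd < N 1 (Suc R)" "N (Suc n) R < i" "Suc j < N (Suc n) (Suc R)"
    "i = N n Pc + trunc n (u Pc)" "Suc j = N n Pd + lead n (u Pd)"
proof -
  have i1: "1 \<le> i" and ij: "i \<le> j" and before: "\<not> zero (u (i - 1))"
    and inside: "\<And>t. i \<le> t \<Longrightarrow> t \<le> j \<Longrightarrow> zero (u t)" and after: "\<not> zero (u (Suc j))"
    using assms by (auto simp: block_def)
  define cut where "cut n \<longleftrightarrow> (\<exists>P. i \<le> N n P \<and> N n P \<le> Suc j)" for n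
  have cut0: "cut 0" unfolding cut_def using ij by (intro exI[of _ i]) (simp add: N_0_left)
  \<comment> \<open>The first positive index already has a cut point \<open>E n > n\<close>, so cuts
    of high level lie beyond the block.\<close>
  have cut_le: "n \<le> Suc j" if "cut n" for n
  proof -
    obtain P where P: "i \<le> N n P" "N n P \<le> Suc j" using \<open>cut n\<close> by (auto simp: cut_def)
    then have "P \<noteq> 0" using i1 N_0_right[of n] by (metis not_one_le_zero le_trans)
    then have "N n 1 \<le> N n P" by (intro N_mono) simp
    then show ?thesis using P E_gt[of n] unfolding N_1 by simp
  qed
  define n where "n = (GREATEST n. cut n)"
  have n: "cut n" "\<And>m. cut m \<Longrightarrow> m \<le> n"
    unfolding n_def using GreatestI_nat[of cut 0 "Suc j"] Greatest_le_nat[of cut _ "Suc j"] cut0 cut_le by blast+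
  then have ncut: "\<not> cut (Suc n)" by fastforce
  obtain P where P: "i \<le> N n P" "N n P \<le> Suc j" using n(1) by (auto simp: cut_def)
  \<comment> \<open>\<open>Pc\<close> is the cell of the nonzero letter just before the block,
    \<open>Pd\<close> that of the nonzero letter just after it; the cut point \<open>P\<close>
    separates them.\<close>
  obtain Pc where Pc: "N n Pc \<le> i - 1" "i - 1 < N n (Suc Pc)" using cell_exists by blast
  obtain Pd where Pd: "N n Pd \<le> Suc j" "Suc j < N n (Suc Pd)" using cell_exists by blast
  obtain R where R: "N (Suc n) R \<le> i - 1" "i - 1 < N (Suc n) (Suc R)" using cell_exists by blast
  have "i \<le> N (Suc n) (Suc R)" using R(2) i1 by linarith
  \<comment> \<open>The level \<open>Suc n\<close> cell of position \<open>i - 1\<close> ends after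
    \<open>i - 1\<close>, but no cut of that level lies from \<open>i\<close> to
    \<open>Suc j\<close>; so it reaches past \<open>Suc j\<close>.\<close>
  then have R2: "Suc j < N (Suc n) (Suc R)" using ncut unfolding cut_def by (meson not_le)
  have "N n Pc < N n P" using Pc P i1 by simp
  then have "Pc < P" by (rule N_less_imp)
  moreover have "N n P < N n (Suc Pd)" using Pd P by simp
  then have "P < Suc Pd" by (rule N_less_imp)
  ultimately have PcPd: "Pc < Pd" by simp
  have "N n Pd < N n (N 1 (Suc R))" using Pd R2 by (simp only: N_Suc_left[symmetric])
  then have PdR: "Pd < N 1 (Suc R)" by (rule N_less_imp)
  have le: "N n (Suc Pc) \<le> N n Pd" using PcPd by (intro N_mono) simp
  have "trunc n (u Pc) = i - N n Pc"
    unfolding trunc_def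
  proof (rule length_dropWhile_rev)
    have len: "length (hpow h n [u Pc]) = N n (Suc Pc) - N n Pc" by (simp add: N_Suc_right)
    show "0 < i - N n Pc" using Pc i1 by simp
    show "i - N n Pc \<le> length (hpow h n [u Pc])" using Pc unfolding len by simp
    have "i - N n Pc - 1 < length (hpow h n [u Pc])" using Pc i1 unfolding len by simp
    from u_cell[OF this] show "\<not> zero (hpow h n [u Pc] ! (i - N n Pc - 1))"
      using before Pc i1 by simp
    fix t assume t: "i - N n Pc \<le> t" "t < length (hpow h n [u Pc])"
    have "N n Pc + t < N n (Suc Pc)" using t(2) unfolding len by simp
    then have "N n Pc + t \<le> j" using le Pd by simp
    then show "zero (hpow h n [u Pc] ! t)" using inside[of "N n Pc + t"] t u_cell[OF t(2)] by simp
  qed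
  then have i_eq: "i = N n Pc + trunc n (u Pc)" using Pc by simp
  have "lead n (u Pd) = Suc j - N n Pd"
    unfolding lead_def
  proof (rule length_takeWhile_eq)
    have len: "length (hpow h n [u Pd]) = N n (Suc Pd) - N n Pd" by (simp add: N_Suc_right)
    show lt: "Suc j - N n Pd < length (hpow h n [u Pd])" using Pd unfolding len by simp
    show "\<not> zero (hpow h n [u Pd] ! (Suc j - N n Pd))" using u_cell[OF lt] after Pd by simp
    fix t assume t: "t < Suc j - N n Pd"
    have "i \<le> N n Pd + t" using le Pc i1 by simp
    moreover have "N n Pd + t \<le> j" using t by simp
    ultimately show "zero (hpow h n [u Pd] ! t)"
      using inside[of "N n Pd + t"] u_cell[of t n Pd] t lt by simp
  qed
  then have j_eq: "Suc j = N n Pd + lead n (u Pd)" using Pd by simp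
  have "N (Suc n) R < i" using R i1 by simp
  from that[OF PcPd PdR this R2 i_eq j_eq] show thesis .
qed

definition occ :: "nat \<Rightarrow> nat" where "occ R = card {Q. Q < R \<and> u Q = u R}"

text \<open>Every earlier occurrence of the letter \<open>u R\<close> contributes an image of the
  same length before \<open>i\<close>, and \<open>j - i\<close> is at most that length.\<close>

lemma occ_bound:
  assumes "N n R < i" "j < N n (Suc R)" "i \<le> j"
  shows "occ R * (j - i) < i"
proof -
  have "occ R * length (hpow h n [u R]) = (\<Sum>Q\<in>{Q. Q < R \<and> u Q = u R}. length (hpow h n [u Q]))"
    by (simp add: occ_def)
  also have "\<dots> \<le> N n R" unfolding N_sum by (intro sum_mono2) auto
  finally have "occ R * length (hpow h n [u R]) < i" using assms by simp
  moreover have "j - i \<le> length (hpow h n [u R])" using assms by (simp add: N_Suc_right)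
  ultimately show ?thesis by (meson le_less_trans mult_le_mono2)
qed

text \<open>A position is determined by its letter and the number of earlier occurrences of that
  letter.\<close>

lemma finite_occ_less: "finite {R. occ R < m}"
proof (rule finite_imageD)
  show "finite ((\<lambda>R. (u R, occ R)) ` {R. occ R < m})"
  proof (rule finite_subset)
    show "(\<lambda>R. (u R, occ R)) ` {R. occ R < m} \<subseteq> Alph \<times> {..<m}" using u_Alph by auto
  qed (use finite_Alph in auto)
  have less: "occ R < occ S" if "R < S" "u R = u S" for R S
    unfolding occ_def using that by (intro psubset_card_mono) auto
  show "inj_on (\<lambda>R. (u R, occ R)) {R. occ R < m}"
  proof (rule inj_onI)
    fix R S assume "(u R, occ R) = (u S, occ S)"
    then show "R = S" using less[of R S] less[of S R] by (cases R S rule: linorder_cases) auto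
  qed
qed

end

section \<open>Comparison of growth along subsequences\<close>

lemma growth_same_rate:
  assumes x: "growth x r D C" and y: "growth y s E C'"
    and ks: "filterlim ks at_top sequentially"
    and xy: "\<And>k. x (ks k) \<le> y (ks k)" and yx: "\<And>k. y (ks k) \<le> B * x (ks k)"
  shows "r = s \<and> D = E"
proof (rule ccontr)
  assume neq: "\<not> (r = s \<and> D = E)"
  have pos: "r > 0" "C > 0" "s > 0" "C' > 0" using x y by (auto simp: growth_def)
  have limx: "(\<lambda>k. real (x (ks k)) / (real (ks k choose D) * r ^ ks k)) \<longlonglongrightarrow> C"
    using x filterlim_compose[OF _ ks] unfolding growth_def by blast
  have limy: "(\<lambda>k. real (y (ks k)) / (real (ks k choose E) * s ^ ks k)) \<longlonglongrightarrow> C'"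
    using y filterlim_compose[OF _ ks] unfolding growth_def by blast
  \<comment> \<open>Normalised by the faster growth, the slower sequence tends to 0; the comparison
    on the subsequence \<open>ks\<close> then contradicts the positive constant of the faster
    one.\<close>
  consider "s < r \<or> (s = r \<and> E < D)" | "r < s \<or> (r = s \<and> D < E)" using neq by linarith
  then show False
  proof cases
    case 1
    have lim0: "(\<lambda>k. real (y (ks k)) / (real (ks k choose D) * r ^ ks k)) \<longlonglongrightarrow> 0"
      using filterlim_compose[OF growth_smaller_tendsto_0[OF y pos(1) 1] ks] .
    have "C \<le> 0"
    proof (rule LIMSEQ_le[OF limx lim0], intro exI allI impI)
      fix k
      show "real (x (ks k)) / (real (ks k choose D) * r ^ ks k) \<le> real (y (ks k)) / (real (ks k choose D) * r ^ ks k)"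
        using xy[of k] pos by (intro divide_right_mono) auto
    qed
    then show False using pos by simp
  next
    case 2
    have "(\<lambda>k. real (x (ks k)) / (real (ks k choose E) * s ^ ks k)) \<longlonglongrightarrow> 0"
      using filterlim_compose[OF growth_smaller_tendsto_0[OF x pos(3) 2] ks] .
    from tendsto_mult_right_zero[OF this, of "real B"]
    have lim0: "(\<lambda>k. real B * (real (x (ks k)) / (real (ks k choose E) * s ^ ks k))) \<longlonglongrightarrow> 0" .
    have "C' \<le> 0"
    proof (rule LIMSEQ_le[OF limy lim0], intro exI allI impI)
      fix k
      have "real (y (ks k)) \<le> real (B * x (ks k))" using yx[of k] by (simp only: of_nat_le_iff)
      then have "real (y (ks k)) \<le> real B * real (x (ks k))" by simp
      then have "real (y (ks k)) / (real (ks k choose E) * s ^ ks k) \<le> real B * real (x (ks k)) / (real (ks k choose E) * s ^ ks k)"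
        using pos by (intro divide_right_mono) auto
      then show "real (y (ks k)) / (real (ks k choose E) * s ^ ks k) \<le> real B * (real (x (ks k)) / (real (ks k choose E) * s ^ ks k))"
        by simp
    qed
    then show False using pos by simp
  qed
qed

lemma growth_ratio:
  assumes "growth x r D C" "growth y r D C'"
  shows "(\<lambda>k. real (y k) / real (x k)) \<longlonglongrightarrow> C' / C"
proof -
  have "(\<lambda>k. (real (y k) / (real (k choose D) * r ^ k)) / (real (x k) / (real (k choose D) * r ^ k))) \<longlonglongrightarrow> C' / C"
    using assms by (intro tendsto_divide) (auto simp: growth_def)
  then show ?thesis
  proof (rule Lim_transform_eventually)
    show "\<forall>\<^sub>F k in sequentially. (real (y k) / (real (k choose D) * r ^ k)) / (real (x k) / (real (k choose D) * r ^ k))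
        = real (y k) / real (x k)"
      using eventually_ge_at_top[of D]
    proof eventually_elim
      case (elim k)
      then have "real (k choose D) * r ^ k \<noteq> 0" using assms(1) by (simp add: growth_def)
      then show ?case by simp
    qed
  qed
qed

lemma constant_subsequence:
  assumes "finite (range f)"
  shows "\<exists>(\<sigma> :: nat \<Rightarrow> nat) b. strict_mono \<sigma> \<and> (\<forall>s. f (\<sigma> s) = b)"
proof -
  obtain t where t: "infinite {s. f s = f t}"
    using pigeonhole_infinite[OF infinite_UNIV_nat assms] by auto
  have "strict_mono (enumerate {s. f s = f t})" using t by (rule strict_mono_enumerate)
  moreover have "f (enumerate {s. f s = f t} s) = f t" for s using enumerate_in_set[OF t, of s] by simp
  ultimately show ?thesis by blast
qed

section \<open>Letters with all-zero images and the linear bound on block ends\<close>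

context morphic
begin

text \<open>A letter whose \<open>n\<close>-th image is empty also belongs to this set.\<close>

definition Z :: "nat \<Rightarrow> nat set" where
  "Z n = {c \<in> Alph. \<forall>e\<in>set (hpow h n [c]). zero e}"

lemma Z_Suc: "Z (Suc n) = {c \<in> Alph. set (h c) \<subseteq> Z n}"
proof -
  have "(\<forall>e\<in>set (hpow h (Suc n) [c]). zero e) \<longleftrightarrow> set (h c) \<subseteq> Z n" if "c \<in> Alph" for c
    unfolding hpow_Suc_singleton set_hpow[of n h "h c"] using h_Alph[OF that] by (auto simp: Z_def)
  then show ?thesis by (auto simp: Z_def)
qed

text \<open>\<open>Z (Suc n)\<close> is determined by \<open>Z n\<close>, and there are only
  finitely many subsets of the alphabet.\<close>

lemma Z_eventually_periodic: "\<exists>n0. \<exists>p>0. \<forall>n\<ge>n0. Z (n + p) = Z n"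
proof -
  have "range Z \<subseteq> Pow Alph" by (auto simp: Z_def)
  then have "finite (range Z)" using finite_Alph finite_subset by blast
  then have "\<not> inj Z" using finite_imageD infinite_UNIV_nat by blast
  then obtain n1 n2 where n: "n1 < n2" "Z n1 = Z n2" unfolding inj_def by (metis nat_neq_iff)
  have "Z (n1 + k + (n2 - n1)) = Z (n1 + k)" for k
  proof (induction k)
    case (Suc k)
    then show ?case by (simp add: Z_Suc)
  qed (use n in simp)
  then have per: "Z (m + (n2 - n1)) = Z m" if "m \<ge> n1" for m
    using that by (metis le_add_diff_inverse)
  show ?thesis by (rule exI[of _ n1], rule exI[of _ "n2 - n1"]) (use n per in auto)
qed

lemma set_hpow_x: "set (hpow h m x) = u ` {E m..<E (Suc m)}"
proof -
  have "U (E (Suc m)) = U (E m) @ hpow h m x" by (simp only: hpow_a[symmetric] hpow_a_Suc)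
  then have "hpow h m x = drop (E m) (U (E (Suc m)))" by simp
  then show ?thesis by (simp add: U_def drop_map)
qed

lemma zero_x_image: "set x \<subseteq> Z m \<longleftrightarrow> (\<forall>t\<in>{E m..<E (Suc m)}. zero (u t))"
proof -
  have "set x \<subseteq> Z m \<longleftrightarrow> (\<forall>e\<in>set (hpow h m x). zero e)"
    unfolding set_hpow[of m h x] using x_Alph by (auto simp: Z_def)
  then show ?thesis by (simp add: set_hpow_x)
qed

text \<open>The stretch from \<open>E m\<close> to \<open>E (Suc m)\<close> is the
  \<open>m\<close>-th image of \<open>x\<close>. Were these stretches all zero for one full period
  of \<open>Z\<close>, they would be zero forever.\<close>

lemma nonzero_gap_bound:
  assumes inf: "\<And>n. \<exists>m\<ge>n. \<not> zero (u m)" and p: "\<And>n. n \<ge> n0 \<Longrightarrow> Z (n + p) = Z n" "p > 0" "n \<ge> n0"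
  shows "\<exists>t. E n \<le> t \<and> t < E (n + p) \<and> \<not> zero (u t)"
proof (rule ccontr)
  assume no: "\<not> ?thesis"
  have first: "set x \<subseteq> Z (n + k)" if "k < p" for k
    unfolding zero_x_image
  proof
    fix t assume "t \<in> {E (n + k)..<E (Suc (n + k))}"
    moreover have "E n \<le> E (n + k)" "E (Suc (n + k)) \<le> E (n + p)" using that by (auto intro: E_mono)
    ultimately show "zero (u t)" using no by auto
  qed
  have all: "set x \<subseteq> Z (n + k)" for k
  proof (induction k rule: less_induct)
    case (less k)
    show ?case
    proof (cases "k < p")
      case False
      then have "Z (n + k) = Z (n + (k - p))" using p(1)[of "n + (k - p)"] p(3) by simp
      then show ?thesis using less[of "k - p"] False p(2) by simp
    qed (rule first)
  qed
  have "zero (u t)" if "E n \<le> t" "t < E (n + k)" for k t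
    using that
  proof (induction k)
    case (Suc k)
    show ?case
    proof (cases "t < E (n + k)")
      case False
      then show ?thesis using all[of k] Suc.prems unfolding zero_x_image by simp
    qed (use Suc in simp)
  qed simp
  moreover obtain t where "E n \<le> t" "\<not> zero (u t)" using inf by blast
  moreover have "t < E (n + t)" using E_gt[of "n + t"] by simp
  ultimately show False by blast
qed

lemma E_add_le: "\<exists>M. \<forall>n k. E (n + k) \<le> M ^ k * E n"
proof -
  define M where "M = Max ((\<lambda>c. length (h c)) ` Alph)"
  have M: "length (h c) \<le> M" if "c \<in> Alph" for c
    unfolding M_def using finite_Alph that by (intro Max_ge) auto
  have le: "length (hom_ext h y) \<le> M * length y" if "set y \<subseteq> Alph" for y
    using that
  proof (induction y)
    case (Cons c y)
    then show ?case using M[of c] by simp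
  qed simp
  have "E (n + k) \<le> M ^ k * E n" for n k
  proof (induction k)
    case (Suc k)
    have "E (Suc (n + k)) \<le> M * E (n + k)"
      using le[OF hpow_Alph[of "[a]" "n + k"]] a_Alph by (simp add: E_def)
    also have "\<dots> \<le> M * (M ^ k * E n)" using Suc by (rule mult_le_mono2)
    finally show ?case by (simp add: mult.assoc)
  qed simp
  then show ?thesis by blast
qed

text \<open>If \<open>E t <= i < E (Suc t)\<close>, a nonzero letter occurs before
  \<open>E (Suc t + p)\<close>, which exceeds \<open>E t\<close> by at most a constant factor. This
  gives the finiteness of the limsup.\<close>

lemma block_end_bound:
  assumes inf: "\<And>n. \<exists>m\<ge>n. \<not> zero (u m)"
  shows "\<exists>B n1. \<forall>i j. block i j \<longrightarrow> i \<ge> n1 \<longrightarrow> Suc j \<le> B * i"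
proof -
  obtain n0 p where p: "p > 0" "\<forall>n\<ge>n0. Z (n + p) = Z n" using Z_eventually_periodic by blast
  obtain M where M: "\<forall>n k. E (n + k) \<le> M ^ k * E n" using E_add_le by blast
  have "Suc j \<le> M ^ Suc p * i" if b: "block i j" "i \<ge> E n0" for i j
  proof -
    define T where "T = (LEAST T. i < E T)"
    have T: "i < E T" unfolding T_def by (rule LeastI[of _ i]) (rule E_gt)
    have "n0 < T"
    proof (rule ccontr)
      assume "\<not> n0 < T"
      then have "E T \<le> E n0" by (intro E_mono) simp
      then show False using T b(2) by simp
    qed
    then obtain t where t: "T = Suc t" "n0 \<le> t" by (cases T) auto
    have Et: "E t \<le> i" using not_less_Least[of t "\<lambda>T. i < E T"] t(1) by (simp add: T_def)
    have "\<exists>s. E T \<le> s \<and> s < E (T + p) \<and> \<not> zero (u s)"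
      by (rule nonzero_gap_bound[OF inf, of n0]) (use p t in auto)
    then obtain s where s: "E T \<le> s" "s < E (T + p)" "\<not> zero (u s)" by blast
    have "j < s" using s(1,3) T b(1) unfolding block_def by (meson atLeastAtMost_iff less_imp_le le_trans not_less)
    then have "Suc j \<le> E (t + Suc p)" using s(2) t(1) by simp
    also have "\<dots> \<le> M ^ Suc p * E t" by (rule M[rule_format])
    also have "\<dots> \<le> M ^ Suc p * i" using Et by (rule mult_le_mono2)
    finally show ?thesis .
  qed
  then show ?thesis by blast
qed

section \<open>Image lengths, trimmed lengths and leading zero counts as one linear system\<close>

definition stat :: "nat \<Rightarrow> nat \<times> nat \<Rightarrow> nat" where
  "stat n i = (if fst i = 0 then length (hpow h n [snd i])
     else if fst i = 1 then trunc n (snd i) else lead n (snd i))"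

definition stats :: "(nat \<times> nat) set" where "stats = {0, 1, 2} \<times> Alph"

lemma finite_stats: "finite stats"
  using finite_Alph by (simp add: stats_def)

text \<open>The coefficients are natural numbers depending on the set \<open>S\<close> of all-zero
  letters but not on the level \<open>n\<close>; this is what makes a matrix constant in
  time.\<close>

definition stat_linear :: "nat set \<Rightarrow> (nat \<Rightarrow> nat) \<Rightarrow> bool" where
  "stat_linear S f \<longleftrightarrow> (\<exists>\<alpha>. \<forall>n. Z n = S \<longrightarrow> f n = (\<Sum>i\<in>stats. \<alpha> i * stat n i))"

lemma stat_linear_stat:
  assumes "i \<in> stats"
  shows "stat_linear S (\<lambda>n. stat n i)"
  unfolding stat_linear_def
proof (intro exI allI impI)
  fix n
  show "stat n i = (\<Sum>j\<in>stats. (if j = i then 1 else 0) * stat n j)"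
    using finite_stats assms by (simp add: mult_delta_left)
qed

lemma stat_linear_0: "stat_linear S (\<lambda>n. 0)"
  unfolding stat_linear_def by (rule exI[of _ "\<lambda>_. 0"]) simp

lemma stat_linear_add:
  assumes "stat_linear S f" "stat_linear S g"
  shows "stat_linear S (\<lambda>n. f n + g n)"
proof -
  obtain \<alpha> \<beta> where "\<forall>n. Z n = S \<longrightarrow> f n = (\<Sum>i\<in>stats. \<alpha> i * stat n i)"
    "\<forall>n. Z n = S \<longrightarrow> g n = (\<Sum>i\<in>stats. \<beta> i * stat n i)"
    using assms unfolding stat_linear_def by blast
  then show ?thesis unfolding stat_linear_def
    by (intro exI[of _ "\<lambda>i. \<alpha> i + \<beta> i"]) (simp add: algebra_simps sum.distrib)
qed

lemma stat_linear_length: "set y \<subseteq> Alph \<Longrightarrow> stat_linear S (\<lambda>n. length (hpow h n y))"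
proof (induction y)
  case Nil
  then show ?case by (simp add: stat_linear_0)
next
  case (Cons c y)
  then have "stat_linear S (\<lambda>n. stat n (0, c) + length (hpow h n y))"
    by (intro stat_linear_add stat_linear_stat) (auto simp: stats_def)
  moreover have "length (hpow h n (c # y)) = stat n (0, c) + length (hpow h n y)" for n
    by (subst hpow_Cons) (simp add: stat_def)
  ultimately show ?case by simp
qed

lemma stat_linear_trunc: "c \<in> Alph \<Longrightarrow> stat_linear S (\<lambda>n. trunc n c)"
  using stat_linear_stat[of "(1, c)" S] by (simp add: stats_def stat_def)

lemma stat_linear_lead: "c \<in> Alph \<Longrightarrow> stat_linear S (\<lambda>n. lead n c)"
  using stat_linear_stat[of "(2, c)" S] by (simp add: stats_def stat_def)

lemma stat_linear_cong:
  assumes "stat_linear S g" "\<And>n. Z n = S \<Longrightarrow> f n = g n"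
  shows "stat_linear S f"
  using assms unfolding stat_linear_def by metis

text \<open>Write the \<open>p\<close>-th image of the letter as \<open>y\<close>. For
  \<open>trunc\<close>, letters of \<open>y\<close> after the last one outside \<open>S\<close> are
  dropped, that letter contributes its own \<open>trunc\<close>, and all earlier ones their full
  length. For \<open>lead\<close>, the first letter outside \<open>S\<close> stops the count in the
  same way.\<close>

lemma stat_linear_step:
  assumes i: "i \<in> stats"
  shows "stat_linear S (\<lambda>n. stat (n + p) i)"
proof -
  obtain b c where bc: "i = (b, c)" "b \<in> {0, 1, 2}" "c \<in> Alph" using i by (auto simp: stats_def)
  define y where "y = hpow h p [c]"
  have y: "set y \<subseteq> Alph" using hpow_Alph[of "[c]" p] bc by (simp add: y_def)
  have hp: "hpow h (n + p) [c] = hpow h n y" for n by (simp add: y_def hpow_add)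
  have allz: "\<forall>e\<in>set (hpow h n z). zero e" if "Z n = S" "set z \<subseteq> S" for n z
    unfolding set_hpow[of n h z] using that by (auto simp: Z_def)
  have somenz: "\<exists>e\<in>set (hpow h n [d]). \<not> zero e" if "Z n = S" "d \<in> Alph" "d \<notin> S" for n d
    using that by (auto simp: Z_def)
  consider "b = 0" | "b = 1" | "b = 2" using bc by auto
  then show ?thesis
  proof cases
    case 1
    then show ?thesis using stat_linear_length[OF y, of S] by (simp add: bc stat_def hp)
  next
    case 2
    then have eq: "stat (n + p) i = length (dropWhile zero (rev (hpow h n y)))" for n
      by (simp add: bc stat_def trunc_def hp)
    show ?thesis
    proof (cases "set y \<subseteq> S")
      case True
      have "stat (n + p) i = 0" if "Z n = S" for n
        using allz[OF that True] by (simp add: eq)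
      then show ?thesis by (intro stat_linear_cong[OF stat_linear_0])
    next
      case False
      then have "\<exists>d\<in>set y. d \<notin> S" by blast
      from split_list_last_prop[OF this] obtain y1 d y2 where
        split: "y = y1 @ d # y2" "d \<notin> S" "set y2 \<subseteq> S" by blast
      have yA: "set y1 \<subseteq> Alph" "d \<in> Alph" using y split by auto
      have "stat (n + p) i = length (hpow h n y1) + trunc n d" if n: "Z n = S" for n
      proof -
        have "hpow h n y = hpow h n y1 @ hpow h n [d] @ hpow h n y2"
          unfolding split(1) hpow_append by (subst hpow_Cons) simp
        then have "rev (hpow h n y) = rev (hpow h n y2) @ rev (hpow h n [d]) @ rev (hpow h n y1)" by simp
        moreover have "dropWhile zero (rev (hpow h n y2) @ w) = dropWhile zero w" for w
          using allz[OF n split(3)] by (intro dropWhile_append2) auto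
        moreover obtain e where "e \<in> set (rev (hpow h n [d]))" "\<not> zero e"
          using somenz[OF n yA(2) split(2)] by auto
        then have "dropWhile zero (rev (hpow h n [d]) @ w) = dropWhile zero (rev (hpow h n [d])) @ w" for w
          by (rule dropWhile_append1)
        ultimately show ?thesis by (simp add: eq trunc_def)
      qed
      then show ?thesis
        by (intro stat_linear_cong[OF stat_linear_add[OF stat_linear_length[OF yA(1)] stat_linear_trunc[OF yA(2)]]])
    qed
  next
    case 3
    then have eq: "stat (n + p) i = length (takeWhile zero (hpow h n y))" for n
      by (simp add: bc stat_def lead_def hp)
    show ?thesis
    proof (cases "set y \<subseteq> S")
      case True
      have "stat (n + p) i = length (hpow h n y)" if "Z n = S" for n
        using allz[OF that True] by (simp add: eq takeWhile_eq_all_conv[THEN iffD2])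
      then show ?thesis by (intro stat_linear_cong[OF stat_linear_length[OF y]])
    next
      case False
      then have "\<exists>d\<in>set y. d \<notin> S" by blast
      from split_list_first_prop[OF this] obtain y1 d y2 where
        split: "y = y1 @ d # y2" "d \<notin> S" "set y1 \<subseteq> S" by blast
      have yA: "set y1 \<subseteq> Alph" "d \<in> Alph" using y split by auto
      have "stat (n + p) i = length (hpow h n y1) + lead n d" if n: "Z n = S" for n
      proof -
        have "hpow h n y = hpow h n y1 @ hpow h n [d] @ hpow h n y2"
          unfolding split(1) hpow_append by (subst hpow_Cons) simp
        moreover have "takeWhile zero (hpow h n y1 @ w) = hpow h n y1 @ takeWhile zero w" for w
          using allz[OF n split(3)] by (intro takeWhile_append2) auto
        moreover obtain e where "e \<in> set (hpow h n [d])" "\<not> zero e"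
          using somenz[OF n yA(2) split(2)] by auto
        then have "takeWhile zero (hpow h n [d] @ w) = takeWhile zero (hpow h n [d])" for w
          by (rule takeWhile_append1)
        ultimately show ?thesis by (simp add: eq lead_def)
      qed
      then show ?thesis
        by (intro stat_linear_cong[OF stat_linear_add[OF stat_linear_length[OF yA(1)] stat_linear_lead[OF yA(2)]]])
    qed
  qed
qed

text \<open>When levels advance by a period of \<open>Z\<close>, the set \<open>S\<close> stays the
  same, so the same coefficients apply at each step.\<close>

lemma stat_linear_system:
  assumes "\<And>k. Z (n1 + p * k) = S"
  shows "\<exists>A. linear_system stats A (\<lambda>k. stat (n1 + p * k))"
proof -
  have "\<forall>i\<in>stats. \<exists>\<alpha>. \<forall>n. Z n = S \<longrightarrow> stat (n + p) i = (\<Sum>j\<in>stats. \<alpha> j * stat n j)"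
    using stat_linear_step[of _ S p] by (simp add: stat_linear_def)
  then obtain A where A: "\<forall>i\<in>stats. \<forall>n. Z n = S \<longrightarrow> stat (n + p) i = (\<Sum>j\<in>stats. A i j * stat n j)"
    unfolding bchoice_iff by blast
  have "stat (n1 + p * Suc k) i = (\<Sum>j\<in>stats. A i j * stat (n1 + p * k) j)" if "i \<in> stats" for i k
  proof -
    have "stat (n1 + p * Suc k) i = stat (n1 + p * k + p) i" by (simp add: algebra_simps)
    then show ?thesis using A that assms by simp
  qed
  then show ?thesis using finite_stats by (auto simp: linear_system_def)
qed

lemma stat_linear_start: "stat_linear S (\<lambda>n. N n P + trunc n (u P))"
  and stat_linear_end: "stat_linear S (\<lambda>n. N n P + lead n (u P))"
  unfolding N_def using u_Alph
  by (auto intro!: stat_linear_add stat_linear_length stat_linear_trunc stat_linear_lead simp: U_def)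

end

lemma shift_act_sum_seq:
  "shift_act p (\<lambda>k. \<Sum>j\<in>S. b j * x j k) k = (\<Sum>j\<in>S. b j * shift_act p (x j) k)"
proof -
  have "shift_act p (\<lambda>k. \<Sum>j\<in>S. b j * x j k) k = (\<Sum>i\<le>degree p. \<Sum>j\<in>S. b j * (coeff p i * x j (k + i)))"
    by (simp add: shift_act_def sum_distrib_left mult.left_commute)
  also have "\<dots> = (\<Sum>j\<in>S. b j * shift_act p (x j) k)"
    by (subst sum.swap) (simp add: shift_act_def sum_distrib_left)
  finally show ?thesis .
qed

section \<open>The limit of the ratios along a sequence of blocks\<close>

context morphic
begin

lemma stat_linear_regular:
  assumes f: "stat_linear S f" and S: "\<And>k. Z (n1 + q * k) = S"
    and reg: "\<And>i. i \<in> stats \<Longrightarrow> regular_growth (\<lambda>k. stat (n1 + q * k) i)"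
    and p: "\<And>i k. i \<in> stats \<Longrightarrow> shift_act p (\<lambda>k. of_nat (stat (n1 + q * k) i)) k = (0 :: rat)"
  shows "regular_growth (\<lambda>k. f (n1 + q * k)) \<and>
    (\<forall>k. shift_act (map_poly of_rat p) (\<lambda>k. real (f (n1 + q * k))) k = 0)"
proof -
  obtain \<alpha> where \<alpha>: "\<And>k. f (n1 + q * k) = (\<Sum>i\<in>stats. \<alpha> i * stat (n1 + q * k) i)"
    using f S unfolding stat_linear_def by blast
  have "shift_act (map_poly of_rat p) (\<lambda>k. real (f (n1 + q * k))) k = 0" for k
  proof -
    have "shift_act p (\<lambda>k. of_nat (f (n1 + q * k))) k
        = (\<Sum>i\<in>stats. of_nat (\<alpha> i) * shift_act p (\<lambda>k. of_nat (stat (n1 + q * k) i)) k)"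
      unfolding \<alpha> of_nat_sum of_nat_mult by (rule shift_act_sum_seq)
    then show ?thesis using p by (simp add: shift_act_of_rat)
  qed
  moreover have "regular_growth (\<lambda>k. f (n1 + q * k))"
    unfolding \<alpha> by (intro regular_growth_sum regular_growth_mult finite_stats reg)
  ultimately show ?thesis by blast
qed

lemma trunc_le: "trunc n c \<le> length (hpow h n [c])"
  unfolding trunc_def using length_dropWhile_le[of zero "rev (hpow h n [c])"] by simp

lemma lead_le: "lead n c \<le> length (hpow h n [c])"
  unfolding lead_def by (rule length_takeWhile_le)

lemma length_hpow_uniform:
  assumes "\<forall>c\<in>Alph. length (h c) = m" "set y \<subseteq> Alph"
  shows "length (hpow h n y) = m ^ n * length y"
proof (induction n)
  case (Suc n)
  have "length (hom_ext h z) = m * length z" if "set z \<subseteq> Alph" for z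
    using that by (induction z) (use assms(1) in auto)
  from this[OF hpow_Alph[OF assms(2), of n]] show ?case using Suc by simp
qed simp

text \<open>The conclusion is phrased through subfields so that one argument serves both cases: the
  rationals when \<open>r\<close> is rational, and a field of algebraic numbers containing
  \<open>r\<close> otherwise.\<close>

lemma block_ratio_limit:
  assumes inf: "\<And>n. \<exists>m\<ge>n. \<not> zero (u m)"
    and blk: "\<And>t. block (I t) (J t)" and mono: "strict_mono I"
    and lim: "(\<lambda>t. real (J t) / real (I t)) \<longlonglongrightarrow> L" and L: "L > 1"
  obtains p :: "rat poly" and r :: real where "p \<noteq> 0" "poly (map_poly of_rat p) r = 0"
    "\<And>K. real_subfield K \<Longrightarrow> r \<in> K \<Longrightarrow> L \<in> K"
    "\<And>m. \<forall>c\<in>Alph. length (h c) = m \<Longrightarrow> r \<in> \<rat>"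
proof -
  have I_ge: "t \<le> I t" for t using mono by (rule strict_mono_imp_increasing)
  obtain B0 b0 where bound: "\<forall>i j. block i j \<longrightarrow> i \<ge> b0 \<longrightarrow> Suc j \<le> B0 * i"
    using block_end_bound[OF inf] by blast
  obtain n0 p where p: "p > 0" "\<forall>n\<ge>n0. Z (n + p) = Z n" using Z_eventually_periodic by blast
  \<comment> \<open>With this \<open>m\<close>, a ratio above \<open>(1 + L) / 2\<close> makes
    \<open>m\<close> times the difference of end and start larger than the start, so
    \<open>occ_bound\<close> allows fewer than \<open>m\<close> earlier occurrences.\<close>
  obtain m :: nat where m: "2 / (L - 1) < real m" using reals_Archimedean2 by blast
  have m1: "2 < real m * (L - 1)" using m L by (simp add: field_simps)
  have "m > 0" using m1 L by (cases m) auto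
  have "\<forall>\<^sub>F t in sequentially. real (J t) / real (I t) > (1 + L) / 2"
    using lim L by (intro order_tendstoD(1)) auto
  then obtain t1 where t1: "\<And>t. t \<ge> t1 \<Longrightarrow> real (J t) / real (I t) > (1 + L) / 2"
    by (auto simp: eventually_sequentially)
  define t0 where "t0 = max t1 b0"

  have "\<forall>t. \<exists>n R Pc Pd. Pc < Pd \<and> Pd < N 1 (Suc R) \<and> N (Suc n) R < I t \<and> Suc (J t) < N (Suc n) (Suc R) \<and>
    I t = N n Pc + trunc n (u Pc) \<and> Suc (J t) = N n Pd + lead n (u Pd)"
  proof
    fix t
    show "\<exists>n R Pc Pd. Pc < Pd \<and> Pd < N 1 (Suc R) \<and> N (Suc n) R < I t \<and> Suc (J t) < N (Suc n) (Suc R) \<and>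
      I t = N n Pc + trunc n (u Pc) \<and> Suc (J t) = N n Pd + lead n (u Pd)"
      by (rule block_parameters[OF blk[of t]]) blast
  qed
  then obtain n R Pc Pd where par: "\<And>t. Pc t < Pd t" "\<And>t. Pd t < N 1 (Suc (R t))"
    "\<And>t. N (Suc (n t)) (R t) < I t" "\<And>t. Suc (J t) < N (Suc (n t)) (Suc (R t))"
    "\<And>t. I t = N (n t) (Pc t) + trunc (n t) (u (Pc t))" "\<And>t. Suc (J t) = N (n t) (Pd t) + lead (n t) (u (Pd t))"
    by metis

  have occ_less: "occ (R t) < m" if t: "t \<ge> t0" for t
  proof -
    have IJ: "I t \<le> J t" "I t \<ge> 1" using blk[of t] by (auto simp: block_def)
    have "occ (R t) * (J t - I t) < I t"
      by (rule occ_bound[OF par(3)]) (use par(4)[of t] IJ in auto)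
    then have 1: "real (occ (R t)) * (real (J t) - real (I t)) < real (I t)"
      using IJ by (metis of_nat_diff of_nat_less_iff of_nat_mult)
    have "real (J t) > (1 + L) / 2 * real (I t)"
      using t1[of t] t IJ by (simp add: t0_def pos_less_divide_eq)
    then have "real (J t) - real (I t) > (L - 1) / 2 * real (I t)" by (simp add: field_simps)
    then have "real m * (real (J t) - real (I t)) > real m * ((L - 1) / 2 * real (I t))"
      using \<open>m > 0\<close> by simp
    moreover have "1 * real (I t) \<le> (real m * ((L - 1) / 2)) * real (I t)"
      using m1 by (intro mult_right_mono) auto
    ultimately have 2: "real m * (real (J t) - real (I t)) > real (I t)" by simp
    show ?thesis
    proof (rule ccontr)
      assume "\<not> occ (R t) < m"
      then have "real m * (real (J t) - real (I t)) \<le> real (occ (R t)) * (real (J t) - real (I t))"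
        using IJ by (intro mult_right_mono) auto
      then show False using 1 2 by simp
    qed
  qed
  \<comment> \<open>Only finitely many \<open>R\<close> remain, so \<open>Pd\<close>, and with it
    \<open>Pc\<close>, stays below a constant.\<close>
  define Q where "Q = Max ((\<lambda>R. N 1 (Suc R)) ` {R. occ R < m})"
  have Pd_less: "Pd t < Q" if t: "t \<ge> t0" for t
  proof -
    have "N 1 (Suc (R t)) \<le> Q"
      unfolding Q_def using finite_occ_less occ_less[OF t] by (intro Max_ge) auto
    then show ?thesis using par(2)[of t] by simp
  qed
  \<comment> \<open>First pigeonhole: fix the two positions and the residue of the level modulo the
    period of \<open>Z\<close>.\<close>
  have "range (\<lambda>t. (Pc (t + t0), Pd (t + t0), n (t + t0) mod p)) \<subseteq> {..<Q} \<times> {..<Q} \<times> {..<p}"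
  proof
    fix z assume "z \<in> range (\<lambda>t. (Pc (t + t0), Pd (t + t0), n (t + t0) mod p))"
    then obtain t where "z = (Pc (t + t0), Pd (t + t0), n (t + t0) mod p)" by blast
    then show "z \<in> {..<Q} \<times> {..<Q} \<times> {..<p}"
      using Pd_less[of "t + t0"] par(1)[of "t + t0"] p(1) by simp
  qed
  then have "finite (range (\<lambda>t. (Pc (t + t0), Pd (t + t0), n (t + t0) mod p)))"
    using finite_subset by blast
  from constant_subsequence[OF this]
  obtain \<sigma>1 :: "nat \<Rightarrow> nat" and b where \<sigma>1: "strict_mono \<sigma>1" "\<forall>s. (Pc (\<sigma>1 s + t0), Pd (\<sigma>1 s + t0), n (\<sigma>1 s + t0) mod p) = b"
    by blast
  obtain c d \<rho>1 where b: "b = (c, d, \<rho>1)" by (cases b) auto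
  define \<tau>1 where "\<tau>1 s = \<sigma>1 s + t0" for s
  have \<tau>1: "Pc (\<tau>1 s) = c" "Pd (\<tau>1 s) = d" "n (\<tau>1 s) mod p = \<rho>1" "s \<le> \<tau>1 s" for s
    using \<sigma>1(2)[rule_format, of s] strict_mono_imp_increasing[OF \<sigma>1(1), of s] by (auto simp: b \<tau>1_def)
  have \<tau>1_mono: "strict_mono \<tau>1" using \<sigma>1(1) by (simp add: strict_mono_def \<tau>1_def)
  have cd: "c < d" using par(1)[of "\<tau>1 0"] \<tau>1[of 0] by simp

  \<comment> \<open>With the position \<open>c\<close> fixed, bounded levels would bound the starts
    \<open>I\<close>, which tend to infinity.\<close>
  have n_lim: "filterlim (\<lambda>s. n (\<tau>1 s)) at_top sequentially"
    unfolding filterlim_at_top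
  proof
    fix k
    define B where "B = Max ((\<lambda>n. N n (Suc c)) ` {..k})"
    have "n (\<tau>1 s) \<ge> k" if "s > B" for s
    proof (rule ccontr)
      assume "\<not> k \<le> n (\<tau>1 s)"
      then have "N (n (\<tau>1 s)) (Suc c) \<le> B" unfolding B_def by (intro Max_ge) auto
      moreover have "I (\<tau>1 s) \<le> N (n (\<tau>1 s)) (Suc c)"
        unfolding par(5) \<tau>1(1) N_Suc_right by (intro add_left_mono trunc_le)
      moreover have "s \<le> I (\<tau>1 s)" using I_ge \<tau>1(4) le_trans by blast
      ultimately show False using that by simp
    qed
    then show "\<forall>\<^sub>F s in sequentially. k \<le> n (\<tau>1 s)"
      using eventually_gt_at_top[of B] by (rule eventually_mono[rotated]) blast
  qed
  then have "\<forall>\<^sub>F s in sequentially. n0 \<le> n (\<tau>1 s)" by (simp add: filterlim_at_top)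
  then obtain s1 where s1: "\<And>s. s \<ge> s1 \<Longrightarrow> n0 \<le> n (\<tau>1 s)" by (auto simp: eventually_sequentially)
  define n1 where "n1 = n (\<tau>1 s1)"
  have n1: "n0 \<le> n1" unfolding n1_def by (rule s1) simp
  have "\<forall>\<^sub>F s in sequentially. n1 \<le> n (\<tau>1 s)" using n_lim by (simp add: filterlim_at_top)
  then obtain s2 where s2: "\<And>s. s \<ge> s2 \<Longrightarrow> n1 \<le> n (\<tau>1 s)" by (auto simp: eventually_sequentially)
  define \<kappa> where "\<kappa> s = (n (\<tau>1 (s + s2)) - n1) div p" for s
  have \<kappa>: "n (\<tau>1 (s + s2)) = n1 + p * \<kappa> s" for s
  proof -
    have "n1 \<le> n (\<tau>1 (s + s2))" by (rule s2) simp
    moreover have "n (\<tau>1 (s + s2)) mod p = n1 mod p" by (simp add: n1_def \<tau>1(3))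
    ultimately have "p dvd n (\<tau>1 (s + s2)) - n1" by (simp add: mod_eq_dvd_iff_nat)
    then show ?thesis using \<open>n1 \<le> n (\<tau>1 (s + s2))\<close> by (simp add: \<kappa>_def)
  qed

  define S where "S = Z n1"
  have ZS: "Z (n1 + p * k) = S" for k
  proof (induction k)
    case (Suc k)
    have "Z (n1 + p * Suc k) = Z (n1 + p * k + p)" by (simp add: algebra_simps)
    then show ?case using p(2) n1 Suc by simp
  qed (simp add: S_def)
  obtain A where "linear_system stats A (\<lambda>k. stat (n1 + p * k))" using stat_linear_system[OF ZS] by blast
  from linear_system_eventually_regular[OF this] obtain q where q: "q > 0"
    "\<forall>s. \<exists>B. linear_system stats B (\<lambda>k. stat (n1 + p * (q * k + s))) \<and>
       (\<forall>i\<in>stats. regular_growth (\<lambda>k. stat (n1 + p * (q * k + s)) i))"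
    by blast
  \<comment> \<open>Second pigeonhole: fix also the residue modulo \<open>q\<close>, so that the
    levels lie in one class on which all coordinates grow regularly.\<close>
  have "range (\<lambda>s. \<kappa> s mod q) \<subseteq> {..<q}" using q(1) by auto
  then have "finite (range (\<lambda>s. \<kappa> s mod q))" using finite_subset by blast
  from constant_subsequence[OF this]
  obtain \<sigma>2 :: "nat \<Rightarrow> nat" and \<rho> where \<sigma>2: "strict_mono \<sigma>2" "\<forall>s. \<kappa> (\<sigma>2 s) mod q = \<rho>"
    by blast
  define ks where "ks s = \<kappa> (\<sigma>2 s) div q" for s
  define T where "T s = \<tau>1 (\<sigma>2 s + s2)" for s
  define n2 q2 where "n2 = n1 + p * \<rho>" and "q2 = p * q"
  have nT: "n (T s) = n2 + q2 * ks s" for s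
  proof -
    have "\<kappa> (\<sigma>2 s) = q * ks s + \<rho>" using mult_div_mod_eq[of q "\<kappa> (\<sigma>2 s)"] \<sigma>2(2)[rule_format, of s] by (simp add: ks_def)
    then show ?thesis unfolding T_def \<kappa> by (simp add: n2_def q2_def algebra_simps)
  qed
  have n2_alt: "n1 + p * (q * k + \<rho>) = n2 + q2 * k" for k by (simp add: n2_def q2_def algebra_simps)
  have T_mono: "strict_mono T" using \<tau>1_mono \<sigma>2(1) by (auto simp: T_def strict_mono_def)
  obtain A2 where sys2: "linear_system stats A2 (\<lambda>k. stat (n2 + q2 * k))"
    and reg2: "\<And>i. i \<in> stats \<Longrightarrow> regular_growth (\<lambda>k. stat (n2 + q2 * k) i)"
    using q(2)[rule_format, of \<rho>] unfolding n2_alt by blast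
  have Z2: "Z (n2 + q2 * k) = S" for k using ZS[of "q * k + \<rho>"] unfolding n2_alt .
  obtain P where P: "P \<noteq> 0" "\<And>i k. i \<in> stats \<Longrightarrow> shift_act P (\<lambda>k. of_nat (stat (n2 + q2 * k) i)) k = (0 :: rat)"
    using linear_system_annihilator[OF sys2] by blast

  have ks_lim: "filterlim ks at_top sequentially"
    unfolding filterlim_at_top
  proof
    fix k
    have "filterlim (\<lambda>s. \<sigma>2 s + s2) at_top sequentially"
      by (rule filterlim_subseq) (use \<sigma>2(1) in \<open>simp add: strict_mono_def\<close>)
    from filterlim_compose[OF n_lim this]
    have "\<forall>\<^sub>F s in sequentially. n2 + q2 * k \<le> n (T s)" by (simp add: filterlim_at_top T_def)
    then show "\<forall>\<^sub>F s in sequentially. k \<le> ks s"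
      by eventually_elim (use p(1) q(1) in \<open>simp add: nT q2_def\<close>)
  qed

  \<comment> \<open>\<open>X\<close> and \<open>Y\<close> are the start and one plus the end of the
    block, extended to all levels of the class; actual blocks occur at the indices
    \<open>ks s\<close>.\<close>
  define X where "X = (\<lambda>k. N (n2 + q2 * k) c + trunc (n2 + q2 * k) (u c))"
  define Y where "Y = (\<lambda>k. N (n2 + q2 * k) d + lead (n2 + q2 * k) (u d))"
  have IX: "I (T s) = X (ks s)" and JY: "Suc (J (T s)) = Y (ks s)" for s
    using par(5,6)[of "T s"] \<tau>1(1,2)[of "\<sigma>2 s + s2"] by (simp_all add: X_def Y_def nT T_def[symmetric])
  have X: "regular_growth X" "\<And>k. shift_act (map_poly of_rat P) (\<lambda>k. real (X k)) k = 0"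
    using stat_linear_regular[OF stat_linear_start Z2 reg2 P(2), of c] unfolding X_def by blast+
  have Y: "regular_growth Y" "\<And>k. shift_act (map_poly of_rat P) (\<lambda>k. real (Y k)) k = 0"
    using stat_linear_regular[OF stat_linear_end Z2 reg2 P(2), of d] unfolding Y_def by blast+
  have X1: "1 \<le> X (ks s)" and XY: "X (ks s) \<le> Y (ks s)" for s
    using blk[of "T s"] unfolding IX[symmetric] JY[symmetric] by (auto simp: block_def)
  have YX: "Y (ks s) \<le> B0 * X (ks s)" for s
  proof -
    have "b0 \<le> \<tau>1 s" for s by (simp add: \<tau>1_def t0_def)
    then have "b0 \<le> I (T s)" using I_ge le_trans unfolding T_def by blast
    then show ?thesis unfolding IX[symmetric] JY[symmetric] using bound blk by blast
  qed
  have not_zero: "\<exists>r D C. growth f r D C" if f: "regular_growth f" and pos: "\<And>s. 1 \<le> f (ks s)" for f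
  proof -
    have "\<not> (\<forall>\<^sub>F k in sequentially. f k = 0)"
    proof
      assume "\<forall>\<^sub>F k in sequentially. f k = 0"
      then have "\<forall>\<^sub>F s in sequentially. f (ks s) = 0" using ks_lim by (rule eventually_compose_filterlim)
      then have "\<forall>\<^sub>F s :: nat in sequentially. False" by eventually_elim (use pos in \<open>metis not_one_le_zero\<close>)
      then show False by simp
    qed
    then show ?thesis using f by (simp add: regular_growth_def)
  qed
  obtain r D C where gX: "growth X r D C" using not_zero[OF X(1) X1] by blast
  obtain r' D' C' where gY': "growth Y r' D' C'" using not_zero[OF Y(1) le_trans[OF X1 XY]] by blast
  \<comment> \<open>The end lies between the start and a constant multiple of it infinitely often,
    so both sequences have the same rate and degree.\<close>
  have "r = r' \<and> D = D'" by (rule growth_same_rate[OF gX gY' ks_lim XY YX])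
  then have gY: "growth Y r D C'" using gY' by simp

  have "(\<lambda>s. real (J (T s)) / real (I (T s))) \<longlonglongrightarrow> L"
    using LIMSEQ_subseq_LIMSEQ[OF lim T_mono] by (simp add: o_def)
  moreover have "(\<lambda>s. real (J (T s)) / real (I (T s))) \<longlonglongrightarrow> C' / C"
  proof -
    have l1: "(\<lambda>s. real (Y (ks s)) / real (X (ks s))) \<longlonglongrightarrow> C' / C"
      by (rule filterlim_compose[OF growth_ratio[OF gX gY] ks_lim])
    have "(\<lambda>s. 1 / real (I (T s))) \<longlonglongrightarrow> 0"
    proof -
      have "strict_mono (\<lambda>s. I (T s))" using mono T_mono by (simp add: strict_mono_def)
      then have "filterlim (\<lambda>s. I (T s)) at_top sequentially" by (rule filterlim_subseq)
      from filterlim_compose[OF lim_1_over_n this] show ?thesis by simp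
    qed
    \<comment> \<open>\<open>Y\<close> counts one more than the end, and the resulting summand
      \<open>1 / I\<close> vanishes in the limit.\<close>
    from tendsto_diff[OF l1 this] show ?thesis
      unfolding IX[symmetric] JY[symmetric] by (simp add: add_divide_distrib)
  qed
  ultimately have L_eq: "L = C' / C" by (rule LIMSEQ_unique)

  show thesis
  proof (rule that)
    show "P \<noteq> 0" by (rule P(1))
    show "poly (map_poly of_rat P) r = 0" by (rule growth_rate_root[OF gX X(2)])
    show "L \<in> K" if K: "real_subfield K" "r \<in> K" for K
    proof -
      have cK: "coeff (map_poly of_rat P) i \<in> K" for i
        by (simp add: coeff_map_poly real_subfield_of_rat[OF K(1)])
      have P0: "map_poly of_rat P \<noteq> (0 :: real poly)" using P(1) by simp
      have "C \<in> K" by (rule growth_constant_in_subfield[OF K(1) gX K(2) P0 cK X(2)])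
      moreover have "C' \<in> K" by (rule growth_constant_in_subfield[OF K(1) gY K(2) P0 cK Y(2)])
      ultimately show ?thesis unfolding L_eq by (intro real_subfield_divide[OF K(1)])
    qed
    show "r \<in> \<rat>" if unif: "\<forall>c\<in>Alph. length (h c) = m" for m
    proof -
      have UA: "set (U k) \<subseteq> Alph" for k using u_Alph by (auto simp: U_def)
      have Nm: "N n k = m ^ n * k" for n k
        using length_hpow_uniform[OF unif UA[of k], of n] by (simp add: N_def)
      have "length (h a) = m" using unif a_Alph by blast
      then have m2: "m > 0" by (auto simp: h_a)
      \<comment> \<open>In the uniform case the cut points are multiples of this power. Since
        \<open>d\<close> is at least 1, \<open>Y\<close> lies between \<open>y\<close> and
        \<open>Suc d * y\<close>, so \<open>r\<close> is the integer \<open>m ^ q2\<close>.\<close>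
      define y where "y k = m ^ (n2 + q2 * k)" for k
      have y_le: "y k \<le> Y k" for k
      proof -
        have "m ^ (n2 + q2 * k) * 1 \<le> m ^ (n2 + q2 * k) * d" using cd by (intro mult_le_mono2) simp
        also have "\<dots> \<le> Y k" by (simp add: Y_def Nm)
        finally show ?thesis by (simp add: y_def)
      qed
      have le_y: "Y k \<le> Suc d * y k" for k
      proof -
        have "Y k \<le> N (n2 + q2 * k) (Suc d)" unfolding Y_def N_Suc_right by (intro add_left_mono lead_le)
        then show ?thesis by (simp add: y_def Nm algebra_simps)
      qed
      have gy: "growth y (real m ^ q2) 0 (real m ^ n2)"
        using m2 by (simp add: growth_def y_def power_add power_mult)
      have "real m ^ q2 = r \<and> 0 = D"
        by (rule growth_same_rate[OF gy gY filterlim_ident y_le le_y])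
      then have "r = of_nat (m ^ q2)" by simp
      then show ?thesis by simp
    qed
  qed
qed

end

section \<open>Conclusion for automatic and morphic words\<close>

theorem theorem4:
  fixes w :: "nat \<Rightarrow> nat" and b :: nat
  assumes "b \<ge> 2"
    and "\<forall>i. w i < b"
    and "\<forall>n. \<exists>m\<ge>n. w m \<noteq> 0"
    and "infinite (zero_block_starts w)"
  shows "(automatic_word w \<longrightarrow>
           (\<exists>r \<in> \<rat>. limsup (\<lambda>k. ereal (real (zb_end w k) / real (zb_start w k))) = ereal r))
       \<and> (morphic_word w \<longrightarrow>
           (\<exists>r :: real. algebraic r \<and>
              limsup (\<lambda>k. ereal (real (zb_end w k) / real (zb_start w k))) = ereal r))"
proof -
  define L where "L = limsup (\<lambda>k. ereal (real (zb_end w k) / real (zb_start w k)))"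
  \<comment> \<open>The value 1 is kept apart because the argument by finitely many pairs of
    positions requires ratios bounded away from 1.\<close>
  have main: "\<exists>l. L = ereal l \<and> (l = 1 \<or> (\<exists>(p :: rat poly) r. p \<noteq> 0 \<and> poly (map_poly of_rat p) r = 0 \<and>
      (\<forall>K. real_subfield K \<longrightarrow> r \<in> K \<longrightarrow> l \<in> K) \<and> (\<forall>m. (\<forall>c\<in>Alph. length (h c) = m) \<longrightarrow> r \<in> \<rat>)))"
    if pm: "pure_morphic_word Alph h a u" and w: "\<forall>i. w i = \<tau> (u i)" for Alph h a u \<tau>
  proof -
    interpret morphic Alph h a u \<tau> by standard (rule pm)
    have wz: "zero (u i) \<longleftrightarrow> w i = 0" for i by (simp add: zero_def w)
    have inf: "\<exists>m\<ge>n. \<not> zero (u m)" for n using assms(3) by (simp add: wz)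
    have start_mono: "strict_mono (zb_start w)"
      unfolding zb_start_def using strict_mono_enumerate[OF assms(4)] by simp
    have start_ge: "k \<le> zb_start w k" for k using start_mono by (rule strict_mono_imp_increasing)
    \<comment> \<open>For \<open>k >= 1\<close> the start is at least \<open>k\<close>, so the case
      of a block at position 0 does not arise.\<close>
    have blk: "block (zb_start w k) (zb_end w k)" if k: "k \<ge> 1" for k
    proof -
      define i where "i = zb_start w k"
      define j where "j = zb_end w k"
      have "i \<in> zero_block_starts w" unfolding i_def zb_start_def by (rule enumerate_in_set[OF assms(4)])
      moreover have i1: "i \<ge> 1" using start_ge[of k] k by (simp add: i_def)
      ultimately have i: "w i = 0" "w (i - 1) \<noteq> 0" by (auto simp: zero_block_starts_def)
      have j_least: "j = (LEAST j. i \<le> j \<and> w (Suc j) \<noteq> 0)" by (simp add: j_def zb_end_def i_def)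
      obtain m where m: "m \<ge> Suc i" "w m \<noteq> 0" using assms(3) by blast
      then have "i \<le> m - 1 \<and> w (Suc (m - 1)) \<noteq> 0" by (cases m) auto
      then have j: "i \<le> j \<and> w (Suc j) \<noteq> 0" unfolding j_least by (rule LeastI)
      have "w t = 0" if t: "i \<le> t" "t \<le> j" for t
      proof (cases "t = i")
        case False
        then obtain t' where t': "t = Suc t'" "i \<le> t'" using t by (cases t) auto
        then have "t' < j" using t by simp
        then show ?thesis using not_less_Least[of t' "\<lambda>j. i \<le> j \<and> w (Suc j) \<noteq> 0"] t' by (simp add: j_least)
      qed (use i in simp)
      then show ?thesis using i i1 j unfolding block_def wz i_def[symmetric] j_def[symmetric] by auto
    qed
    define f where "f k = real (zb_end w k) / real (zb_start w k)" for k
    have L_f: "L = limsup (\<lambda>k. ereal (f k))" by (simp add: L_def f_def)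
    have f1: "f k \<ge> 1" if "k \<ge> 1" for k
      using blk[OF that] by (simp add: f_def block_def)
    obtain B b0 where bound: "\<forall>i j. block i j \<longrightarrow> i \<ge> b0 \<longrightarrow> Suc j \<le> B * i"
      using block_end_bound[OF inf] by blast
    have fB: "f k \<le> real B" if k: "k \<ge> max 1 b0" for k
    proof -
      have "Suc (zb_end w k) \<le> B * zb_start w k"
        using bound blk[of k] k start_ge[of k] by simp
      then have "real (zb_end w k) \<le> real (B * zb_start w k)" by (intro of_nat_mono) simp
      moreover have "zb_start w k > 0" using start_ge[of k] k by simp
      ultimately show ?thesis by (simp add: f_def pos_divide_le_eq)
    qed
    have "L \<le> ereal (real B)"
      unfolding L_f
    proof (rule Limsup_bounded)
      show "\<forall>\<^sub>F k in sequentially. ereal (f k) \<le> ereal (real B)"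
        using eventually_ge_at_top[of "max 1 b0"] by eventually_elim (simp add: fB)
    qed
    moreover have L1: "1 \<le> L"
    proof -
      have "\<forall>\<^sub>F k in sequentially. 1 \<le> ereal (f k)"
        using eventually_ge_at_top[of 1] by eventually_elim (simp add: f1 one_ereal_def)
      then have "1 \<le> liminf (\<lambda>k. ereal (f k))" by (rule Liminf_bounded)
      also have "\<dots> \<le> L" unfolding L_f by (rule Liminf_le_Limsup) simp
      finally show ?thesis .
    qed
    ultimately obtain l where l: "L = ereal l" by (cases L) auto
    show ?thesis
    proof (cases "l = 1")
      case False
      then have l1: "l > 1" using L1 l by (simp add: one_ereal_def)
      obtain \<sigma> where \<sigma>: "strict_mono \<sigma>" "((\<lambda>k. ereal (f k)) \<circ> \<sigma>) \<longlonglongrightarrow> L"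
        unfolding L_f using limsup_subseq_lim by blast
      have "(\<lambda>s. f (\<sigma> s)) \<longlonglongrightarrow> l" using \<sigma>(2) by (simp add: l o_def)
      \<comment> \<open>Shifting the subsequence attaining the limsup by one ensures that all its
        indices are at least 1.\<close>
      from LIMSEQ_Suc[OF this]
      have lim: "(\<lambda>s. real (zb_end w (\<sigma> (Suc s))) / real (zb_start w (\<sigma> (Suc s)))) \<longlonglongrightarrow> l"
        by (simp add: f_def)
      have \<sigma>1: "\<sigma> (Suc s) \<ge> 1" for s using strict_mono_imp_increasing[OF \<sigma>(1), of "Suc s"] by simp
      have mono: "strict_mono (\<lambda>s. zb_start w (\<sigma> (Suc s)))"
        using start_mono \<sigma>(1) by (simp add: strict_mono_def)
      show ?thesis
        by (rule block_ratio_limit[OF inf blk[OF \<sigma>1] mono lim l1]) (use l in blast)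
    qed (use l in blast)
  qed
  have "\<exists>r\<in>\<rat>. L = ereal r" if auto: "automatic_word w"
  proof -
    obtain Alph h a u \<tau> m where aut: "pure_morphic_word Alph h a u" "\<forall>i. w i = \<tau> (u i)"
      "\<forall>c\<in>Alph. length (h c) = m"
      using auto unfolding automatic_word_def by blast
    from main[OF aut(1,2)] obtain l where l: "L = ereal l" "l = 1 \<or> (\<exists>(p :: rat poly) r. p \<noteq> 0 \<and> poly (map_poly of_rat p) r = 0 \<and>
      (\<forall>K. real_subfield K \<longrightarrow> r \<in> K \<longrightarrow> l \<in> K) \<and> (\<forall>m. (\<forall>c\<in>Alph. length (h c) = m) \<longrightarrow> r \<in> \<rat>))"
      by blast
    \<comment> \<open>For a uniform morphism \<open>r\<close> is rational, so the rationals
      themselves are a subfield containing \<open>r\<close>.\<close>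
    then have "l \<in> \<rat>" using aut(3) real_subfield_Rats by auto
    then show ?thesis using l(1) by blast
  qed
  moreover have "\<exists>r :: real. algebraic r \<and> L = ereal r" if mor: "morphic_word w"
  proof -
    obtain Alph h a u \<tau> where mor: "pure_morphic_word Alph h a u" "\<forall>i. w i = \<tau> (u i)"
      using mor unfolding morphic_word_def by blast
    from main[OF mor] obtain l where l: "L = ereal l" "l = 1 \<or> (\<exists>(p :: rat poly) r. p \<noteq> 0 \<and> poly (map_poly of_rat p) r = 0 \<and>
      (\<forall>K. real_subfield K \<longrightarrow> r \<in> K \<longrightarrow> l \<in> K) \<and> (\<forall>m. (\<forall>c\<in>Alph. length (h c) = m) \<longrightarrow> r \<in> \<rat>))"
      by blast
    have "algebraic l"
    proof (cases "l = 1")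
      case False
      then obtain p :: "rat poly" and r where p: "p \<noteq> 0" "poly (map_poly of_rat p) r = 0"
        "\<forall>K. real_subfield K \<longrightarrow> r \<in> K \<longrightarrow> l \<in> K" using l(2) by blast
      then show ?thesis using algebraic_subfield_exists[OF p(1,2)] by blast
    qed simp
    then show ?thesis using l(1) by blast
  qed
  ultimately show ?thesis unfolding L_def by blast
qed

end
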